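(* Let $3\le d<10$ be an integer and $\gamma\in[1,2)$ with $\gamma<2(d-1)/d$. There exists $C>0$ such that every liquid Lane–Emden star with central density $\rho_0>C$ is linearly unstable against radial perturbations (i.e. there is $\chi\in H^1_r$ with $Q[\chi]<0$, and hence a growing mode exists).
   Context: Fix an integer $d\ge 3$ and $\gamma\in[1,2]$. For $\rho_0>0$, the (radial, gaseous) Lane–Emden profile with central density $\rho_0$ is the unique continuous function $\rho:[0,R_g)\to(0,\infty)$, defined on its maximal interval of existence $[0,R_g)$, $R_g\in(0,\infty]$, with $\rho(0)=\rho_0$ and, writing $m(r)=4\pi\int_0^r y^{d-1}\rho(y)\,dy$, $\frac{d}{dr}\big(\rho(r)^\gamma\big)=-\rho(r)\,m(r)/r^{d-1}$ for $0<r<R_g$ (equivalently: for $\gamma>1$, $w=\rho^{\gamma-1}$ satisfies $w'(r)=-4\pi\frac{\gamma-1}{\gamma}r^{1-d}\int_0^r y^{d-1}w(y)^{\alpha}dy$ with $\alpha=1/(\gamma-1)$; for $\gamma=1$, $h=\ln\rho$ satisfies $h'(r)=-4\pi r^{1-d}\int_0^r y^{d-1}e^{h(y)}dy$). This profile is strictly decreasing and tends to $0$ at the end of its interval of existence. If $\rho_0>1$, let $R$ be the unique radius with $\rho(R)=1$; the liquid Lane–Emden star with central density $\rho_0$ is $\bar\rho=\rho|_{[0,R]}$, with radius $R$ and relative central density $\rho_0-1$. For such a star, let $H^1_r$ be the space of functions $\chi:[0,R]\to\mathbb R$ whose radial extension $x\mapsto\chi(|x|)$ lies in $H^1(B_R)$,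 where $B_R\subset\mathbb R^{d+2}$ is the open ball of radius $R$. Define $L\chi=-\gamma\,(\bar\rho^\gamma y^{d+1}\chi')'+(2(d-1)-d\gamma)\,y^d(\bar\rho^\gamma)'\chi$ and the quadratic form $Q[\chi]=\int_0^R\big[\gamma\bar\rho^\gamma y^{d+1}(\chi')^2+(2(d-1)-d\gamma)y^d\chi^2(\bar\rho^\gamma)'\big]dy+d\gamma R^d\chi(R)^2$ (which equals $\int_0^R (L\chi)\chi\,dy$ for smooth $\chi$ with $d\chi(R)+R\chi'(R)=0$). A growing mode is a pair $(\lambda,\chi)$ with $\lambda>0$, $0\neq\chi\in H^1_r\cap C^2((0,R])$, $L\chi=-\lambda^2y^{d+1}\bar\rho\chi$ on $(0,R]$ and $d\chi(R)+R\chi'(R)=0$; these correspond to solutions $\zeta=e^{\lambda t}\chi(y)$ of the radial Euler–Poisson system (pressure $p=\rho^\gamma-1$) linearised in Lagrangian coordinates about $\bar\rho$, with particle paths $\eta(y,t)=y(1+\zeta(y,t))$. The star is linearly unstable (against radial perturbations) if a growing mode exists, and linearly stable otherwise. *)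

theory Defs
  imports "HOL-Analysis.Analysis"
begin

definition LE_mass :: "nat \<Rightarrow> (real \<Rightarrow> real) \<Rightarrow> real \<Rightarrow> real" where
  "LE_mass d \<rho> r = 4 * pi * integral {0..r} (\<lambda>y. y ^ (d - 1) * \<rho> y)"

definition LE_sol :: "nat \<Rightarrow> real \<Rightarrow> real \<Rightarrow> (real \<Rightarrow> real) \<Rightarrow> ereal \<Rightarrow> bool" where
  "LE_sol d \<gamma> \<rho>0 \<rho> b \<longleftrightarrow>
     0 < b \<and>
     continuous_on {r. 0 \<le> r \<and> ereal r < b} \<rho> \<and>
     (\<forall>r. 0 \<le> r \<and> ereal r < b \<longrightarrow> 0 < \<rho> r) \<and>
     \<rho> 0 = \<rho>0 \<and>
     (\<forall>r. 0 < r \<and> ereal r < b \<longrightarrow>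
        ((\<lambda>s. \<rho> s powr \<gamma>) has_real_derivative (- \<rho> r * LE_mass d \<rho> r / r ^ (d - 1))) (at r))"

definition LE_profile :: "nat \<Rightarrow> real \<Rightarrow> real \<Rightarrow> (real \<Rightarrow> real) \<Rightarrow> ereal \<Rightarrow> bool" where
  "LE_profile d \<gamma> \<rho>0 \<rho> Rg \<longleftrightarrow>
     LE_sol d \<gamma> \<rho>0 \<rho> Rg \<and> (\<forall>\<rho>' b. LE_sol d \<gamma> \<rho>0 \<rho>' b \<longrightarrow> b \<le> Rg)"

definition test_fn :: "'a::euclidean_space set \<Rightarrow> ('a \<Rightarrow> real) \<Rightarrow> ('a \<Rightarrow> 'a) \<Rightarrow> bool" where
  "test_fn U \<phi> D\<phi> \<longleftrightarrow>
     continuous_on UNIV D\<phi> \<and>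
     (\<forall>x. (\<phi> has_derivative (\<lambda>h. D\<phi> x \<bullet> h)) (at x)) \<and>
     compact (closure {x. \<phi> x \<noteq> 0}) \<and> closure {x. \<phi> x \<noteq> 0} \<subseteq> U"

definition H1 :: "'a::euclidean_space set \<Rightarrow> ('a \<Rightarrow> real) \<Rightarrow> bool" where
  "H1 U u \<longleftrightarrow>
     u \<in> borel_measurable (lebesgue_on U) \<and>
     integrable (lebesgue_on U) (\<lambda>x. (u x)\<^sup>2) \<and>
     (\<exists>G :: 'a \<Rightarrow> 'a.
        G \<in> borel_measurable (lebesgue_on U) \<and>
        integrable (lebesgue_on U) (\<lambda>x. (norm (G x))\<^sup>2) \<and>
        (\<forall>\<phi> D\<phi>. test_fn U \<phi> D\<phi> \<longrightarrow>
           (\<forall>i\<in>Basis.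
              integral\<^sup>L (lebesgue_on U) (\<lambda>x. u x * (D\<phi> x \<bullet> i)) =
              - integral\<^sup>L (lebesgue_on U) (\<lambda>x. (G x \<bullet> i) * \<phi> x))))"

text \<open>chi in H^1_r: the radial extension x |-> chi(|x|) lies in H^1(B_R), B_R in the space 'a
  (which is taken of dimension d+2 in the theorem).\<close>
definition H1r :: "'a::euclidean_space itself \<Rightarrow> real \<Rightarrow> (real \<Rightarrow> real) \<Rightarrow> bool" where
  "H1r (T::'a itself) R w \<longleftrightarrow> H1 (ball (0::'a) R) (\<lambda>x. w (norm x))"

definition growing_mode ::
  "'a::euclidean_space itself \<Rightarrow> nat \<Rightarrow> real \<Rightarrow> (real \<Rightarrow> real) \<Rightarrow> real \<Rightarrow> real \<Rightarrow> (real \<Rightarrow> real) \<Rightarrow> bool" where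
  "growing_mode T d \<gamma> \<rho> R lam w \<longleftrightarrow>
     0 < lam \<and>
     (\<exists>y\<in>{0<..R}. w y \<noteq> 0) \<and>
     H1r T R w \<and>
     (\<exists>w1 w2.
        continuous_on {0<..R} w2 \<and>
        (\<forall>y\<in>{0<..R}.
           (w has_real_derivative w1 y) (at y within {0<..R}) \<and>
           (w1 has_real_derivative w2 y) (at y within {0<..R}) \<and>
           (\<exists>q' p'.
              ((\<lambda>s. \<rho> s powr \<gamma> * s ^ (d + 1) * w1 s) has_real_derivative q') (at y within {0<..R}) \<and>
              ((\<lambda>s. \<rho> s powr \<gamma>) has_real_derivative p') (at y within {0<..R}) \<and>
              - \<gamma> * q' + (2 * (real d - 1) - real d * \<gamma>) * y ^ d * p' * w y
                = - (lam\<^sup>2) * y ^ (d + 1) * \<rho> y * w y)) \<and>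
        real d * w R + R * w1 R = 0)"

definition linearly_unstable ::
  "'a::euclidean_space itself \<Rightarrow> nat \<Rightarrow> real \<Rightarrow> (real \<Rightarrow> real) \<Rightarrow> real \<Rightarrow> bool" where
  "linearly_unstable T d \<gamma> \<rho> R \<longleftrightarrow> (\<exists>lam w. growing_mode T d \<gamma> \<rho> R lam w)"

end

(*
  In the variables g = r m'/m, u = - r rho'/rho the Lane-Emden equation is an autonomous planar
  system in ln r. If g stayed above its fixed-point value g_c, the angle around the fixed point
  would increase at a definite rate (a spiral, or a repelling node, because d < 10), which bounds
  ln (rho(0)/rho(R)) by a constant depending on d and gamma only. Hence for large central density
  g reaches g_c inside the star. Differentiating the equilibria along their scaling family gives an
  explicit solution of L chi = 0, proportional to 1 - g_c/g, which therefore has an interior zero. Solving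
  L chi = - mu y^(d+1) rho chi from the centre and increasing mu from 0 pushes this zero out
  through the surface; in between, the boundary condition d chi + R chi' = 0 is met for some mu > 0.
*)
theory Submission
  imports Defs
begin

text \<open>The usual route finds a trial function with Q < 0 and obtains the mode as a minimiser.
  Here the mode is built from the differential equation itself: the sign changes of one regular
  solution replace the variational argument, so no compactness or regularity theory for minimisers
  enters. The price is the degeneracy of the equation at the centre, which is absorbed by a Volterra
  formulation. The clock in the phase plane is s = ln (rho(0) / rho(r)): since rho = 1 on the
  surface, s equals ln rho(0) there, so a bound on s while g stays above g_c is a bound on the
  central density. The obstacle to a definite rotation rate is that the quadratic form governing the
  angle may be indefinite and is followed by a cubic term of bad sign where u < u_c. Two a priori
  facts repair this as long as g > g_c: the trajectory stays in the sector g + u > d, and the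
  negative part of u - u_c decays exponentially in s. The hypothesis gamma < 2(d-1)/d says g_c > 0;
  the coefficient 2(d-1) - d gamma of L is (2 - gamma) g_c.\<close>

section \<open>Linear Volterra equations\<close>

text \<open>Linearity is demanded only for differences, the form in which contraction and uniqueness
  use it. The last clause, a bound by the supremum over \<open>{0..x}\<close> alone, lets an
  exponential weight beat \<open>C\<close> on the whole interval.\<close>

definition causal_op :: "real \<Rightarrow> real \<Rightarrow> ((real \<Rightarrow> real) \<Rightarrow> real \<Rightarrow> real) \<Rightarrow> bool" where
  "causal_op R C A \<longleftrightarrow> 0 \<le> C \<and>
     (\<forall>\<phi>. continuous_on {0..R} \<phi> \<longrightarrow> continuous_on {0..R} (A \<phi>)) \<and>
     (\<forall>\<phi> \<psi>. continuous_on {0..R} \<phi> \<longrightarrow> continuous_on {0..R} \<psi> \<longrightarrow>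
        (\<forall>x\<in>{0..R}. A (\<lambda>z. \<phi> z - \<psi> z) x = A \<phi> x - A \<psi> x)) \<and>
     (\<forall>\<phi> x B. continuous_on {0..R} \<phi> \<longrightarrow> x \<in> {0..R} \<longrightarrow> (\<forall>z\<in>{0..x}. \<bar>\<phi> z\<bar> \<le> B) \<longrightarrow> \<bar>A \<phi> x\<bar> \<le> C * B)"

lemma causal_opD:
  assumes "causal_op R C A"
  shows "0 \<le> C"
    and "continuous_on {0..R} \<phi> \<Longrightarrow> continuous_on {0..R} (A \<phi>)"
    and "continuous_on {0..R} \<phi> \<Longrightarrow> continuous_on {0..R} \<psi> \<Longrightarrow> x \<in> {0..R} \<Longrightarrow>
         A (\<lambda>z. \<phi> z - \<psi> z) x = A \<phi> x - A \<psi> x"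
    and "continuous_on {0..R} \<phi> \<Longrightarrow> x \<in> {0..R} \<Longrightarrow> (\<And>z. z \<in> {0..x} \<Longrightarrow> \<bar>\<phi> z\<bar> \<le> B) \<Longrightarrow> \<bar>A \<phi> x\<bar> \<le> C * B"
  using assms unfolding causal_op_def by blast+

lemma integrable_on_initial:
  fixes f :: "real \<Rightarrow> real"
  assumes "continuous_on {0..R} f" "y \<le> R"
  shows "f integrable_on {0..y}"
  by (rule integrable_continuous_real) (use assms continuous_on_subset in fastforce)

lemma integral_bound_initial:
  fixes f :: "real \<Rightarrow> real"
  assumes f: "continuous_on {0..R} f" and x: "x \<in> {0..R}" and B: "\<And>z. z \<in> {0..x} \<Longrightarrow> \<bar>f z\<bar> \<le> B"
  shows "\<bar>integral {0..x} f\<bar> \<le> B * x"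
  using integral_bound[of 0 x f B] x B continuous_on_subset[OF f, of "{0..x}"] by auto

text \<open>Integrating \<open>exp (K * x)\<close> gains a factor \<open>1 / K\<close>, and
  \<open>C / K < 1 / 2\<close> by the choice of \<open>K\<close>. So in the norm weighted by
  \<open>exp (- K * x)\<close> the integrated operator halves lengths, however long the interval
  is.\<close>

lemma causal_op_weighted_bound:
  assumes A: "causal_op R C A" and \<phi>: "continuous_on {0..R} \<phi>" and y: "y \<in> {0..R}"
    and K: "K = 2 * C + 1" and B: "\<And>z. z \<in> {0..R} \<Longrightarrow> \<bar>\<phi> z\<bar> \<le> B * exp (K * z)"
  shows "\<bar>integral {0..y} (A \<phi>)\<bar> \<le> B * exp (K * y) / 2"
proof -
  note D = causal_opD[OF A]
  have C: "0 \<le> C" by (rule D(1))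
  have K0: "K > 0" using K C by simp
  have B0: "0 \<le> B" using B[of 0] y by auto
  have I: "((\<lambda>x. C * B * exp (K * x)) has_integral C * B * exp (K * y) / K - C * B * exp (K * 0) / K) {0..y}"
    using y K0 by (intro fundamental_theorem_of_calculus)
      (auto simp: has_real_derivative_iff_has_vector_derivative[symmetric] intro!: derivative_eq_intros)
  have "norm (integral {0..y} (A \<phi>)) \<le> integral {0..y} (\<lambda>x. C * B * exp (K * x))"
  proof (rule integral_norm_bound_integral)
    show "A \<phi> integrable_on {0..y}" using y by (intro integrable_on_initial[OF D(2)[OF \<phi>]]) auto
    show "(\<lambda>x. C * B * exp (K * x)) integrable_on {0..y}" using I by blast
    fix x assume x: "x \<in> {0..y}"
    have "\<bar>A \<phi> x\<bar> \<le> C * (B * exp (K * x))"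
    proof (rule D(4)[OF \<phi>])
      fix z assume z: "z \<in> {0..x}"
      have "B * exp (K * z) \<le> B * exp (K * x)" using z K0 B0 by (intro mult_left_mono) auto
      then show "\<bar>\<phi> z\<bar> \<le> B * exp (K * x)" using B[of z] z x y by auto
    qed (use x y in auto)
    then show "norm (A \<phi> x) \<le> C * B * exp (K * x)" by (simp add: mult.assoc)
  qed
  also have "\<dots> \<le> C * B * exp (K * y) / K"
    unfolding integral_unique[OF I] using C B0 K0 by simp
  also have "\<dots> \<le> B * exp (K * y) / 2"
    using K0 B0 C K by (simp add: divide_simps) (simp add: algebra_simps)
  finally show ?thesis by simp
qed

text \<open>At the maximum of \<open>\<bar>\<phi>\<bar> * exp (- K * y)\<close> the integral is at
  most half of the left-hand side and can be absorbed; this is the factor 2. With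
  \<open>E = 0\<close> it yields uniqueness, with small \<open>E\<close> continuous
  dependence.\<close>

lemma causal_op_gronwall:
  assumes A: "causal_op R C A" and \<phi>: "continuous_on {0..R} \<phi>"
    and E: "\<And>y. y \<in> {0..R} \<Longrightarrow> \<bar>\<phi> y\<bar> \<le> E + \<bar>integral {0..y} (A \<phi>)\<bar>" and y: "y \<in> {0..R}"
  shows "\<bar>\<phi> y\<bar> \<le> 2 * E * exp ((2 * C + 1) * R)"
proof -
  define K where "K = 2 * C + 1"
  have K0: "K > 0" using causal_opD(1)[OF A] by (simp add: K_def)
  have c: "continuous_on {0..R} (\<lambda>z. \<bar>\<phi> z\<bar> * exp (- K * z))"
    by (intro continuous_intros \<phi>)
  have "{0..R} \<noteq> {}" using y by auto
  from continuous_attains_sup[OF compact_Icc this c] obtain x where x: "x \<in> {0..R}"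
    and xm: "\<And>z. z \<in> {0..R} \<Longrightarrow> \<bar>\<phi> z\<bar> * exp (- K * z) \<le> \<bar>\<phi> x\<bar> * exp (- K * x)"
    by blast
  define B where "B = \<bar>\<phi> x\<bar> * exp (- K * x)"
  have B: "\<bar>\<phi> z\<bar> \<le> B * exp (K * z)" if "z \<in> {0..R}" for z
  proof -
    have "\<bar>\<phi> z\<bar> = \<bar>\<phi> z\<bar> * exp (- K * z) * exp (K * z)" by (simp add: mult.assoc flip: exp_add)
    also have "\<dots> \<le> B * exp (K * z)" using xm[OF that] by (intro mult_right_mono) (auto simp: B_def)
    finally show ?thesis .
  qed
  have E0: "0 \<le> E" using E[of 0] y by auto
  have "\<bar>\<phi> x\<bar> \<le> E + B * exp (K * x) / 2"
    using E[OF x] causal_op_weighted_bound[OF A \<phi> x K_def B] by linarith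
  moreover have "B * exp (K * x) = \<bar>\<phi> x\<bar>" by (simp add: B_def mult.assoc flip: exp_add)
  ultimately have "\<bar>\<phi> x\<bar> \<le> 2 * E" by simp
  moreover have "B \<le> \<bar>\<phi> x\<bar> * 1" unfolding B_def using x K0 by (intro mult_left_mono) auto
  ultimately have "B \<le> 2 * E" by simp
  have "\<bar>\<phi> y\<bar> \<le> B * exp (K * y)" by (rule B[OF y])
  also have "\<dots> \<le> 2 * E * exp (K * R)"
    using \<open>B \<le> 2 * E\<close> E0 y K0 by (intro mult_mono) auto
  finally show ?thesis by (simp add: K_def)
qed

text \<open>Banach's fixed point theorem with the exponential weight built into the unknown: the
  fixed point is \<open>exp (- K * y)\<close> times the solution, and \<open>W\<close> restores the
  factor.\<close>

lemma volterra_solution_exists: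
  assumes A: "causal_op R C A" and R: "0 \<le> R"
  shows "\<exists>\<xi>. continuous_on {0..R} \<xi> \<and> (\<forall>y\<in>{0..R}. \<xi> y = 1 + integral {0..y} (A \<xi>))"
proof -
  note D = causal_opD[OF A]
  define K where "K = 2 * C + 1"
  \<comment> \<open>A retraction onto \<open>{0..R}\<close>: composing with it turns functions on
    the interval into bounded continuous functions on the line, which form a complete metric
    space.\<close>
  define cl where "cl y = max 0 (min R y)" for y :: real
  have cl: "cl y \<in> {0..R}" for y using R by (auto simp: cl_def)
  have ccl: "continuous_on UNIV cl" unfolding cl_def by (intro continuous_intros)
  define W where "W \<phi> z = exp (K * z) * apply_bcontfun \<phi> z" for \<phi> :: "real \<Rightarrow>\<^sub>C real" and z
  have Wc: "continuous_on S (W \<phi>)" for S \<phi>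
    unfolding W_def by (intro continuous_intros continuous_on_apply_bcontfun)
  define g where "g \<phi> y = exp (- K * y) * (1 + integral {0..y} (A (W \<phi>)))" for \<phi> y
  have gc: "continuous_on {0..R} (g \<phi>)" for \<phi>
    unfolding g_def
    by (intro continuous_intros indefinite_integral_continuous_1 integrable_continuous_real D(2) Wc)
  define T where "T \<phi> = Bcontfun (\<lambda>y. g \<phi> (cl y))" for \<phi>
  have T: "apply_bcontfun (T \<phi>) y = g \<phi> (cl y)" for \<phi> y
  proof -
    obtain b where b: "\<And>z. z \<in> {0..R} \<Longrightarrow> norm (g \<phi> z) \<le> b"
      using compact_imp_bounded[OF compact_continuous_image[OF gc compact_Icc]]
      by (metis bounded_iff imageI)
    have "continuous_on UNIV (\<lambda>y. g \<phi> (cl y))"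
      by (rule continuous_on_compose2[OF gc ccl]) (use cl in auto)
    then have "(\<lambda>y. g \<phi> (cl y)) \<in> bcontfun"
      by (rule bcontfun_normI) (use b cl in auto)
    then show ?thesis by (simp add: T_def Bcontfun_inverse)
  qed
  have "\<exists>!\<phi>. T \<phi> = \<phi>"
  proof (rule banach_fix_type[of "1/2"])
    show "\<forall>\<phi> \<psi>. dist (T \<phi>) (T \<psi>) \<le> 1 / 2 * dist \<phi> \<psi>"
    proof (intro allI dist_bound)
      fix \<phi> \<psi> :: "real \<Rightarrow>\<^sub>C real" and y
      let ?y = "cl y"
      let ?d = "\<lambda>z. W \<phi> z - W \<psi> z"
      have dc: "continuous_on {0..R} ?d" by (intro continuous_intros Wc)
      have "integral {0..?y} (A ?d) = integral {0..?y} (\<lambda>x. A (W \<phi>) x - A (W \<psi>) x)"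
        by (rule integral_cong) (use D(3)[OF Wc Wc] cl[of y] in auto)
      also have "\<dots> = integral {0..?y} (A (W \<phi>)) - integral {0..?y} (A (W \<psi>))"
        using cl[of y] by (intro integral_diff integrable_on_initial[OF D(2)[OF Wc]]) auto
      finally have eq: "g \<phi> ?y - g \<psi> ?y = exp (- K * ?y) * integral {0..?y} (A ?d)"
        unfolding g_def by algebra
      have "\<bar>integral {0..?y} (A ?d)\<bar> \<le> dist \<phi> \<psi> * exp (K * ?y) / 2"
      proof (rule causal_op_weighted_bound[OF A dc cl K_def])
        fix z
        have "\<bar>?d z\<bar> = \<bar>apply_bcontfun \<phi> z - apply_bcontfun \<psi> z\<bar> * exp (K * z)"
          by (simp add: W_def abs_mult flip: right_diff_distrib)
        also have "\<dots> \<le> dist \<phi> \<psi> * exp (K * z)"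
          using dist_bounded[of \<phi> z \<psi>] by (intro mult_right_mono) (auto simp: dist_real_def)
        finally show "\<bar>?d z\<bar> \<le> dist \<phi> \<psi> * exp (K * z)" .
      qed
      then have "exp (- K * ?y) * \<bar>integral {0..?y} (A ?d)\<bar> \<le> exp (- K * ?y) * (dist \<phi> \<psi> * exp (K * ?y) / 2)"
        by (intro mult_left_mono) auto
      also have "\<dots> = dist \<phi> \<psi> / 2" by (simp add: exp_minus field_simps)
      finally show "dist (apply_bcontfun (T \<phi>) y) (apply_bcontfun (T \<psi>) y) \<le> 1 / 2 * dist \<phi> \<psi>"
        by (simp add: T dist_real_def eq abs_mult)
    qed
  qed auto
  then obtain \<phi> where \<phi>: "T \<phi> = \<phi>" by blast
  have "W \<phi> y = 1 + integral {0..y} (A (W \<phi>))" if "y \<in> {0..R}" for y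
  proof -
    have "cl y = y" using that by (auto simp: cl_def)
    then have "apply_bcontfun \<phi> y = g \<phi> y" using T[of \<phi> y] \<phi> by simp
    then show ?thesis unfolding W_def[of \<phi> y] g_def by (simp add: exp_minus field_simps)
  qed
  then show ?thesis using Wc by blast
qed

section \<open>Shooting in the spectral parameter\<close>

text \<open>On \<open>{e..y1}\<close> with \<open>e > 0\<close> the coefficients are bounded, so for
  large \<open>K\<close> the energy \<open>E\<close> is nondecreasing, and vanishing at
  \<open>y1\<close> forces it to vanish at \<open>e\<close>. As \<open>1 / p\<close> may blow up at
  \<open>0\<close>, the centre is reached only by continuity of \<open>\<xi>\<close>.\<close>

lemma double_zero_propagates:
  fixes \<xi> V :: "real \<Rightarrow> real"
  assumes cont: "continuous_on {0..R} \<xi>" and y1: "0 < y1" "y1 \<le> R"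
    and p: "continuous_on {0..R} p" "\<And>y. y \<in> {0<..R} \<Longrightarrow> 0 < p y" and q: "continuous_on {0..R} q"
    and d\<xi>: "\<And>y. y \<in> {0<..R} \<Longrightarrow> (\<xi> has_real_derivative V y / p y) (at y within {0..R})"
    and dV: "\<And>y. y \<in> {0<..R} \<Longrightarrow> (V has_real_derivative q y * \<xi> y) (at y within {0..R})"
    and zero: "\<xi> y1 = 0" "V y1 = 0"
  shows "\<xi> 0 = 0"
proof -
  have z: "\<xi> e = 0" if e: "0 < e" "e \<le> y1" for e
  proof -
    have "continuous_on {e..y1} (\<lambda>y. 1 / p y + q y)"
      using e y1 p(2) by (intro continuous_intros continuous_on_subset[OF p(1)] continuous_on_subset[OF q])
        (auto simp: less_imp_neq[THEN not_sym])
    then obtain K where K: "\<And>y. y \<in> {e..y1} \<Longrightarrow> norm (1 / p y + q y) \<le> K"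
      using compact_imp_bounded[OF compact_continuous_image[OF _ compact_Icc]]
      by (metis (no_types, lifting) bounded_iff imageI)
    define E where "E y = ((\<xi> y)\<^sup>2 + (V y)\<^sup>2) * exp (K * y)" for y
    have "E e \<le> E y1"
    proof (rule DERIV_nonneg_imp_increasing_open[OF e(2)])
      fix y assume y: "e < y" "y < y1"
      then have at: "at y within {0..R} = at y" using e y1 by (intro at_within_Icc_at) auto
      have d: "(\<xi> has_real_derivative V y / p y) (at y)" "(V has_real_derivative q y * \<xi> y) (at y)"
        using d\<xi>[of y] dV[of y] y e y1 by (auto simp: at)
      let ?s = "1 / p y + q y"
      have "(E has_real_derivative (2 * \<xi> y * V y * ?s + K * ((\<xi> y)\<^sup>2 + (V y)\<^sup>2)) * exp (K * y)) (at y)"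
        unfolding E_def by (auto intro!: derivative_eq_intros d simp: algebra_simps)
      moreover have "0 \<le> 2 * \<xi> y * V y * ?s + K * ((\<xi> y)\<^sup>2 + (V y)\<^sup>2)"
      proof -
        have k: "\<bar>?s\<bar> \<le> K" using K[of y] y by auto
        have "\<bar>2 * \<xi> y * V y\<bar> \<le> (\<xi> y)\<^sup>2 + (V y)\<^sup>2"
          using sum_squares_bound[of "\<xi> y" "V y"] sum_squares_bound[of "- \<xi> y" "V y"] by (simp add: abs_le_iff)
        then have "\<bar>2 * \<xi> y * V y\<bar> * \<bar>?s\<bar> \<le> ((\<xi> y)\<^sup>2 + (V y)\<^sup>2) * K"
          using k by (intro mult_mono) auto
        then have "\<bar>2 * \<xi> y * V y * ?s\<bar> \<le> ((\<xi> y)\<^sup>2 + (V y)\<^sup>2) * K" by (simp add: abs_mult)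
        then show ?thesis by (simp add: mult.commute[of K])
      qed
      ultimately show "\<exists>D. (E has_real_derivative D) (at y) \<and> 0 \<le> D" by (metis exp_ge_zero mult_nonneg_nonneg)
    next
      have "continuous_on {0<..R} V" "continuous_on {0<..R} \<xi>"
        by (rule DERIV_continuous_on, rule DERIV_subset[OF dV], auto)
          (rule DERIV_continuous_on, rule DERIV_subset[OF d\<xi>], auto)
      then show "continuous_on {e..y1} E"
        unfolding E_def using e y1 by (intro continuous_intros) (auto elim!: continuous_on_subset)
    qed
    then have "E e \<le> 0" using zero by (simp add: E_def)
    then have "(\<xi> e)\<^sup>2 + (V e)\<^sup>2 \<le> 0" by (simp add: E_def mult_le_0_iff not_le[symmetric])
    then show ?thesis by (simp add: sum_power2_le_zero_iff)
  qed
  have "(\<xi> \<longlongrightarrow> \<xi> 0) (at 0 within {0..R})"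
    using cont y1 by (auto simp: continuous_on_def)
  then have "(\<xi> \<longlongrightarrow> \<xi> 0) (at_right 0)"
    using y1 by (simp add: at_within_Icc_at_right)
  moreover have "\<forall>\<^sub>F e in at_right 0. \<xi> e = 0"
    using eventually_at_right_less[of 0] eventually_at_right_real[OF y1(1)]
    by eventually_elim (auto intro: z)
  then have "(\<xi> \<longlongrightarrow> 0) (at_right 0)" by (rule tendsto_eventually)
  ultimately show ?thesis by (rule tendsto_unique[OF trivial_limit_at_right_real])
qed

text \<open>\<open>L\<close> may depend on the base point \<open>\<nu>\<close>: the estimates in the
  spectral parameter below involve a bound for the solution at \<open>\<nu>\<close>.\<close>

lemma continuous_on_of_lipschitz_at:
  fixes f :: "real \<Rightarrow> real"
  assumes "\<And>\<nu>. \<nu> \<in> S \<Longrightarrow> \<exists>L. \<forall>\<mu>\<in>S. \<bar>f \<mu> - f \<nu>\<bar> \<le> L * \<bar>\<mu> - \<nu>\<bar>"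
  shows "continuous_on S f"
  unfolding continuous_on_def
proof
  fix \<nu> assume "\<nu> \<in> S"
  then obtain L where L: "\<And>\<mu>. \<mu> \<in> S \<Longrightarrow> \<bar>f \<mu> - f \<nu>\<bar> \<le> L * \<bar>\<mu> - \<nu>\<bar>" using assms by blast
  have "((\<lambda>\<mu>. L * \<bar>\<mu> - \<nu>\<bar>) \<longlongrightarrow> L * \<bar>\<nu> - \<nu>\<bar>) (at \<nu> within S)"
    by (intro tendsto_intros)
  then have "((\<lambda>\<mu>. f \<mu> - f \<nu>) \<longlongrightarrow> 0) (at \<nu> within S)"
    by (intro Lim_null_comparison[of "\<lambda>\<mu>. f \<mu> - f \<nu>" "\<lambda>\<mu>. L * \<bar>\<mu> - \<nu>\<bar>"])
      (use L in \<open>auto simp: eventually_at_filter\<close>)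
  then show "(f \<longlongrightarrow> f \<nu>) (at \<nu> within S)" by (simp add: LIM_zero_iff)
qed

text \<open>The equation \<open>(p \<xi>')' = (\<mu> \<alpha> - \<beta>) \<xi>\<close> with \<open>p\<close> vanishing at \<open>0\<close>, solved from the regular initial
  value \<open>\<xi> 0 = 1\<close>; \<open>V\<close> below stands for the flux \<open>p \<xi>'\<close>. At \<open>0\<close> the junk value \<open>x / 0 = 0\<close> makes the
  operator \<open>A\<close> continuous.\<close>

locale shooting =
  fixes R C :: real and p \<alpha> \<beta> :: "real \<Rightarrow> real"
  assumes R: "0 < R" and C: "0 \<le> C"
    and cont: "continuous_on {0..R} p" "continuous_on {0..R} \<alpha>" "continuous_on {0..R} \<beta>"
    and p_pos: "y \<in> {0<..R} \<Longrightarrow> 0 < p y"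
    and \<alpha>_nonneg: "y \<in> {0..R} \<Longrightarrow> 0 \<le> \<alpha> y"
    and \<beta>_le: "y \<in> {0..R} \<Longrightarrow> \<bar>\<beta> y\<bar> \<le> C * \<alpha> y"
    and \<alpha>_le: "0 \<le> z \<Longrightarrow> z \<le> y \<Longrightarrow> y \<le> R \<Longrightarrow> \<alpha> z \<le> C * p y"
begin

section \<open>The Volterra operator and its regular solution\<close>

definition q :: "real \<Rightarrow> real \<Rightarrow> real" where "q \<mu> y = \<mu> * \<alpha> y - \<beta> y"

definition A :: "real \<Rightarrow> (real \<Rightarrow> real) \<Rightarrow> real \<Rightarrow> real" where
  "A \<mu> \<phi> x = integral {0..x} (\<lambda>z. q \<mu> z * \<phi> z) / p x"

definition K :: "real \<Rightarrow> real" where "K \<mu> = (\<bar>\<mu>\<bar> + C) * C"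

lemma q_cont: "continuous_on {0..R} (q \<mu>)"
  unfolding q_def by (intro continuous_intros cont)

lemma K_nonneg: "0 \<le> K \<mu>" using C by (simp add: K_def)

text \<open>\<open>q\<close> at \<open>z\<close> is compared with \<open>p\<close> at a later point
  \<open>y\<close>, because \<open>A\<close> divides an integral over \<open>{0..y}\<close> by
  \<open>p y\<close>. This is what tames the degeneracy of \<open>p\<close> at the centre.\<close>

lemma q_le:
  assumes "0 \<le> z" "z \<le> y" "y \<le> R"
  shows "\<bar>q \<mu> z\<bar> \<le> K \<mu> * p y"
proof -
  have "\<bar>q \<mu> z\<bar> \<le> \<bar>\<mu> * \<alpha> z\<bar> + \<bar>\<beta> z\<bar>" unfolding q_def by (rule abs_triangle_ineq4)
  also have "\<dots> \<le> \<bar>\<mu>\<bar> * \<alpha> z + C * \<alpha> z"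
    using \<alpha>_nonneg[of z] \<beta>_le[of z] assms by (simp add: abs_mult)
  also have "\<dots> = (\<bar>\<mu>\<bar> + C) * \<alpha> z" by algebra
  also have "\<dots> \<le> (\<bar>\<mu>\<bar> + C) * (C * p y)"
    using \<alpha>_le[OF assms] C by (intro mult_left_mono) auto
  finally show ?thesis by (simp add: K_def)
qed

text \<open>The factor \<open>x\<close>, the length of the interval of integration, is kept because
  it makes \<open>A \<mu> \<phi>\<close> tend to its value \<open>0\<close> at the centre.\<close>

lemma A_bound:
  assumes \<phi>: "continuous_on {0..R} \<phi>" and x: "x \<in> {0..R}" and B: "\<And>z. z \<in> {0..x} \<Longrightarrow> \<bar>\<phi> z\<bar> \<le> B"
  shows "\<bar>A \<mu> \<phi> x\<bar> \<le> K \<mu> * B * x"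
proof (cases "x = 0")
  case False
  then have px: "0 < p x" using p_pos x by auto
  have B0: "0 \<le> B" using B[of 0] x by auto
  have "\<bar>integral {0..x} (\<lambda>z. q \<mu> z * \<phi> z)\<bar> \<le> (K \<mu> * p x * B) * x"
  proof (rule integral_bound_initial[OF _ x])
    show "continuous_on {0..R} (\<lambda>z. q \<mu> z * \<phi> z)" by (intro continuous_intros q_cont \<phi>)
    fix z assume z: "z \<in> {0..x}"
    have "\<bar>q \<mu> z\<bar> * \<bar>\<phi> z\<bar> \<le> K \<mu> * p x * B"
      using q_le[of z x \<mu>] B[OF z] z x px K_nonneg by (intro mult_mono) auto
    then show "\<bar>q \<mu> z * \<phi> z\<bar> \<le> K \<mu> * p x * B" by (simp add: abs_mult)
  qed
  then show ?thesis using px unfolding A_def by (simp add: divide_simps mult_ac)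
qed (simp add: A_def)

lemma A_cont:
  assumes \<phi>: "continuous_on {0..R} \<phi>"
  shows "continuous_on {0..R} (A \<mu> \<phi>)"
  unfolding continuous_on_eq_continuous_within
proof
  fix x assume x: "x \<in> {0..R}"
  have I: "continuous_on {0..R} (\<lambda>x. integral {0..x} (\<lambda>z. q \<mu> z * \<phi> z))"
    by (intro indefinite_integral_continuous_1 integrable_continuous_real continuous_intros q_cont \<phi>)
  show "continuous (at x within {0..R}) (A \<mu> \<phi>)"
  proof (cases "x = 0")
    case False
    then have "p x \<noteq> 0" using p_pos[of x] x by auto
    then show ?thesis unfolding A_def
      using I cont(1) x by (intro continuous_at_within_divide) (auto simp: continuous_on_eq_continuous_within)
  next
    case True
    obtain B where B: "\<And>z. z \<in> {0..R} \<Longrightarrow> norm (\<phi> z) \<le> B"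
      using compact_imp_bounded[OF compact_continuous_image[OF \<phi> compact_Icc]]
      by (metis bounded_iff imageI)
    have "((\<lambda>x. K \<mu> * B * x) \<longlongrightarrow> K \<mu> * B * 0) (at 0 within {0..R})"
      by (intro tendsto_intros)
    then have "(A \<mu> \<phi> \<longlongrightarrow> 0) (at 0 within {0..R})"
      by (intro Lim_null_comparison[of "A \<mu> \<phi>" "\<lambda>x. K \<mu> * B * x"])
         (use A_bound[OF \<phi>, of _ B \<mu>] B in \<open>auto simp: eventually_at_filter\<close>)
    then show ?thesis using True by (simp add: continuous_within A_def)
  qed
qed

lemma causal_A: "causal_op R (K \<mu> * R) (A \<mu>)"
  unfolding causal_op_def
proof (intro conjI allI impI ballI)
  show "0 \<le> K \<mu> * R" using K_nonneg R by simp
  show "continuous_on {0..R} (A \<mu> \<phi>)" if "continuous_on {0..R} \<phi>" for \<phi> using that by (rule A_cont)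
  show "A \<mu> (\<lambda>z. \<phi> z - \<psi> z) x = A \<mu> \<phi> x - A \<mu> \<psi> x"
    if "continuous_on {0..R} \<phi>" "continuous_on {0..R} \<psi>" "x \<in> {0..R}" for \<phi> \<psi> x
  proof -
    have "integral {0..x} (\<lambda>z. q \<mu> z * \<phi> z - q \<mu> z * \<psi> z)
        = integral {0..x} (\<lambda>z. q \<mu> z * \<phi> z) - integral {0..x} (\<lambda>z. q \<mu> z * \<psi> z)"
      using that by (intro integral_diff integrable_on_initial[of R] continuous_intros q_cont) auto
    then show ?thesis by (simp add: A_def right_diff_distrib diff_divide_distrib)
  qed
  show "\<bar>A \<mu> \<phi> x\<bar> \<le> K \<mu> * R * B"
    if "continuous_on {0..R} \<phi>" "x \<in> {0..R}" and b: "\<forall>z\<in>{0..x}. \<bar>\<phi> z\<bar> \<le> B" for \<phi> x B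
  proof -
    have "0 \<le> B" using bspec[OF b, of 0] that(2) by auto
    have "\<bar>A \<mu> \<phi> x\<bar> \<le> K \<mu> * B * x" using A_bound[OF that(1,2)] b by blast
    also have "\<dots> \<le> K \<mu> * B * R" using K_nonneg \<open>0 \<le> B\<close> that(2) by (intro mult_left_mono) auto
    finally show ?thesis by (simp add: mult_ac)
  qed
qed

definition \<xi> :: "real \<Rightarrow> real \<Rightarrow> real" where
  "\<xi> \<mu> = (SOME \<phi>. continuous_on {0..R} \<phi> \<and> (\<forall>y\<in>{0..R}. \<phi> y = 1 + integral {0..y} (A \<mu> \<phi>)))"

definition V :: "real \<Rightarrow> real \<Rightarrow> real" where
  "V \<mu> y = integral {0..y} (\<lambda>z. q \<mu> z * \<xi> \<mu> z)"

lemma \<xi>: "continuous_on {0..R} (\<xi> \<mu>)" "y \<in> {0..R} \<Longrightarrow> \<xi> \<mu> y = 1 + integral {0..y} (A \<mu> (\<xi> \<mu>))"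
  using someI_ex[OF volterra_solution_exists[OF causal_A less_imp_le[OF R], of \<mu>], folded \<xi>_def]
  by simp_all

lemma A_\<xi>: "A \<mu> (\<xi> \<mu>) y = V \<mu> y / p y" by (simp add: A_def V_def)

lemma \<xi>_0: "\<xi> \<mu> 0 = 1" using \<xi>(2)[of 0 \<mu>] R by simp

lemma V_0: "V \<mu> 0 = 0" by (simp add: V_def)

lemma \<xi>_deriv:
  assumes "y \<in> {0..R}"
  shows "(\<xi> \<mu> has_real_derivative V \<mu> y / p y) (at y within {0..R})"
proof -
  have "((\<lambda>y. 1 + integral {0..y} (A \<mu> (\<xi> \<mu>))) has_real_derivative 0 + A \<mu> (\<xi> \<mu>) y) (at y within {0..R})"
    by (intro DERIV_add DERIV_const integral_has_real_derivative A_cont \<xi>(1) assms)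
  then have "((\<lambda>y. 1 + integral {0..y} (A \<mu> (\<xi> \<mu>))) has_real_derivative V \<mu> y / p y) (at y within {0..R})"
    by (simp add: A_\<xi>)
  then show ?thesis
    by (rule has_field_derivative_transform_within[OF _ zero_less_one assms]) (use \<xi>(2) in auto)
qed

lemma V_deriv:
  assumes "y \<in> {0..R}"
  shows "(V \<mu> has_real_derivative q \<mu> y * \<xi> \<mu> y) (at y within {0..R})"
  unfolding V_def by (intro integral_has_real_derivative continuous_intros q_cont \<xi>(1) assms)

lemma V_cont: "continuous_on {0..R} (V \<mu>)"
  by (rule DERIV_continuous_on[OF V_deriv])

lemma \<xi>_bounded: "\<exists>B\<ge>0. \<forall>y\<in>{0..R}. \<bar>\<xi> \<mu> y\<bar> \<le> B"
proof -
  have "bounded (\<xi> \<mu> ` {0..R})"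
    by (intro compact_imp_bounded compact_continuous_image \<xi>(1) compact_Icc)
  then obtain B where "\<forall>y\<in>{0..R}. \<bar>\<xi> \<mu> y\<bar> \<le> B" by (auto simp: bounded_iff)
  then show ?thesis by (intro exI[of _ "max B 0"]) (auto simp: max.coboundedI1)
qed

text \<open>Serves to recognise an explicit solution as \<open>\<xi> \<mu>\<close>, hence
  derivatives only in the open interval. The difference of two solutions obeys the homogeneous
  Volterra equation, so Gronwall applies with \<open>E = 0\<close>.\<close>

lemma \<xi>_unique:
  assumes \<eta>: "continuous_on {0..R} \<eta>" "\<eta> 0 = 1" and W: "continuous_on {0..R} W" "W 0 = 0"
    and d\<eta>: "\<And>y. y \<in> {0<..<R} \<Longrightarrow> (\<eta> has_real_derivative W y / p y) (at y)"
    and dW: "\<And>y. y \<in> {0<..<R} \<Longrightarrow> (W has_real_derivative q \<mu> y * \<eta> y) (at y)"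
    and y: "y \<in> {0..R}"
  shows "\<eta> y = \<xi> \<mu> y"
proof -
  have eqW: "W x = integral {0..x} (\<lambda>z. q \<mu> z * \<eta> z)" if "x \<in> {0..R}" for x
  proof -
    have "((\<lambda>z. q \<mu> z * \<eta> z) has_integral W x - W 0) {0..x}"
      using that dW by (intro fundamental_theorem_of_calculus_interior continuous_on_subset[OF W(1)])
        (auto simp: has_real_derivative_iff_has_vector_derivative)
    then show ?thesis using W(2) by (simp add: integral_unique)
  qed
  have eq\<eta>: "\<eta> x = 1 + integral {0..x} (A \<mu> \<eta>)" if "x \<in> {0..R}" for x
  proof -
    have "(A \<mu> \<eta> has_integral \<eta> x - \<eta> 0) {0..x}"
      using that d\<eta> eqW by (intro fundamental_theorem_of_calculus_interior continuous_on_subset[OF \<eta>(1)])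
        (auto simp: has_real_derivative_iff_has_vector_derivative A_def)
    then show ?thesis using \<eta>(2) by (simp add: integral_unique)
  qed
  have c: "continuous_on {0..R} (\<lambda>z. \<eta> z - \<xi> \<mu> z)" by (intro continuous_intros \<eta>(1) \<xi>(1))
  have "\<bar>\<eta> y - \<xi> \<mu> y\<bar> \<le> 2 * 0 * exp ((2 * (K \<mu> * R) + 1) * R)"
  proof (rule causal_op_gronwall[OF causal_A c _ y])
    fix x assume x: "x \<in> {0..R}"
    have "integral {0..x} (A \<mu> (\<lambda>z. \<eta> z - \<xi> \<mu> z)) = integral {0..x} (\<lambda>z. A \<mu> \<eta> z - A \<mu> (\<xi> \<mu>) z)"
      by (rule integral_cong) (use x causal_opD(3)[OF causal_A \<eta>(1) \<xi>(1)] in auto)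
    also have "\<dots> = integral {0..x} (A \<mu> \<eta>) - integral {0..x} (A \<mu> (\<xi> \<mu>))"
      using x by (intro integral_diff integrable_on_initial[OF A_cont] \<eta>(1) \<xi>(1)) auto
    also have "\<dots> = \<eta> x - \<xi> \<mu> x" using eq\<eta>[OF x] \<xi>(2)[OF x, of \<mu>] by simp
    finally show "\<bar>\<eta> x - \<xi> \<mu> x\<bar> \<le> 0 + \<bar>integral {0..x} (A \<mu> (\<lambda>z. \<eta> z - \<xi> \<mu> z))\<bar>" by simp
  qed
  then show ?thesis by simp
qed

section \<open>Dependence on the spectral parameter\<close>

lemma A_diff:
  assumes \<phi>: "continuous_on {0..R} \<phi>" and x: "x \<in> {0..R}"
  shows "A \<mu> \<phi> x = A \<nu> \<phi> x + (\<mu> - \<nu>) * (integral {0..x} (\<lambda>z. \<alpha> z * \<phi> z) / p x)"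
proof -
  have "integral {0..x} (\<lambda>z. q \<mu> z * \<phi> z) = integral {0..x} (\<lambda>z. q \<nu> z * \<phi> z + (\<mu> - \<nu>) * (\<alpha> z * \<phi> z))"
    by (rule integral_cong) (simp add: q_def algebra_simps)
  also have "\<dots> = integral {0..x} (\<lambda>z. q \<nu> z * \<phi> z) + (\<mu> - \<nu>) * integral {0..x} (\<lambda>z. \<alpha> z * \<phi> z)"
    using x by (subst integral_add)
      (auto intro!: integrable_on_initial[of R] continuous_intros q_cont cont \<phi>)
  finally show ?thesis by (simp add: A_def add_divide_distrib)
qed

text \<open>The difference of the two solutions obeys the Volterra equation of
  \<open>A \<mu>\<close> with a forcing term proportional to \<open>\<mu> - \<nu>\<close>; Gronwall
  bounds it. Replacing \<open>K \<mu>\<close> by \<open>K \<Lambda>\<close> makes the exponential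
  uniform in \<open>\<mu>\<close>.\<close>

lemma \<xi>_lipschitz:
  assumes \<Lambda>: "0 \<le> \<Lambda>"
  shows "\<exists>L. \<forall>\<mu>\<in>{0..\<Lambda>}. \<forall>y\<in>{0..R}. \<bar>\<xi> \<mu> y - \<xi> \<nu> y\<bar> \<le> L * \<bar>\<mu> - \<nu>\<bar>"
proof -
  obtain B where B: "0 \<le> B" "\<And>y. y \<in> {0..R} \<Longrightarrow> \<bar>\<xi> \<nu> y\<bar> \<le> B" using \<xi>_bounded by blast
  define E where "E = C * B * R * R"
  have E0: "0 \<le> E" using B(1) C R by (simp add: E_def)
  have "\<bar>\<xi> \<mu> y - \<xi> \<nu> y\<bar> \<le> 2 * E * exp ((2 * (K \<Lambda> * R) + 1) * R) * \<bar>\<mu> - \<nu>\<bar>"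
    if \<mu>: "\<mu> \<in> {0..\<Lambda>}" and y: "y \<in> {0..R}" for \<mu> y
  proof -
    let ?d = "\<lambda>z. \<xi> \<mu> z - \<xi> \<nu> z"
    let ?J = "\<lambda>x. integral {0..x} (\<lambda>z. \<alpha> z * \<xi> \<nu> z) / p x"
    have c: "continuous_on {0..R} ?d" by (intro continuous_intros \<xi>(1))
    have J: "\<bar>?J x\<bar> \<le> C * B * R" if x: "x \<in> {0..R}" for x
    proof (cases "x = 0")
      case False
      then have px: "0 < p x" using p_pos x by auto
      have "\<bar>integral {0..x} (\<lambda>z. \<alpha> z * \<xi> \<nu> z)\<bar> \<le> (C * p x * B) * x"
      proof (rule integral_bound_initial[OF _ x])
        show "continuous_on {0..R} (\<lambda>z. \<alpha> z * \<xi> \<nu> z)" by (intro continuous_intros cont \<xi>(1))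
        fix z assume z: "z \<in> {0..x}"
        have "\<alpha> z * \<bar>\<xi> \<nu> z\<bar> \<le> (C * p x) * B"
          using \<alpha>_le[of z x] B(2)[of z] \<alpha>_nonneg[of z] z x px C B(1) by (intro mult_mono) auto
        then show "\<bar>\<alpha> z * \<xi> \<nu> z\<bar> \<le> C * p x * B" using \<alpha>_nonneg[of z] z x by (simp add: abs_mult)
      qed
      also have "\<dots> \<le> (C * p x * B) * R" using x px C B(1) by (intro mult_left_mono) auto
      finally show ?thesis using px by (simp add: divide_simps mult_ac)
    qed (use C B(1) R in auto)
    have "\<bar>?d y\<bar> \<le> 2 * (E * \<bar>\<mu> - \<nu>\<bar>) * exp ((2 * (K \<mu> * R) + 1) * R)"
    proof (rule causal_op_gronwall[OF causal_A c _ y])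
      fix x assume x: "x \<in> {0..R}"
      have i: "A \<mu> ?d integrable_on {0..x}" "A \<nu> (\<xi> \<nu>) integrable_on {0..x}" "A \<mu> (\<xi> \<mu>) integrable_on {0..x}"
        using x by (auto intro!: integrable_on_initial[OF A_cont] c \<xi>(1))
      have eq: "A \<mu> (\<xi> \<mu>) z - A \<nu> (\<xi> \<nu>) z = A \<mu> ?d z + (\<mu> - \<nu>) * ?J z" if "z \<in> {0..x}" for z
        using causal_opD(3)[OF causal_A \<xi>(1) \<xi>(1), of z \<mu> \<mu> \<nu>] A_diff[OF \<xi>(1), of z \<mu> \<nu> \<nu>] that x by auto
      \<comment> \<open>Integrability is read off from \<open>eq\<close>, which writes this function
        as a combination of integrable ones, so that the quotient in \<open>?J\<close> need not be
        studied at the centre.\<close>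
      have J': "(\<lambda>z. (\<mu> - \<nu>) * ?J z) integrable_on {0..x}"
        by (rule integrable_eq[OF integrable_diff[OF integrable_diff[OF i(3) i(2)] i(1)]])
           (use eq in auto)
      have "?d x = integral {0..x} (A \<mu> (\<xi> \<mu>)) - integral {0..x} (A \<nu> (\<xi> \<nu>))"
        using \<xi>(2)[OF x] by simp
      also have "\<dots> = integral {0..x} (\<lambda>z. A \<mu> (\<xi> \<mu>) z - A \<nu> (\<xi> \<nu>) z)"
        by (rule integral_diff[symmetric]) (use i in auto)
      also have "\<dots> = integral {0..x} (\<lambda>z. A \<mu> ?d z + (\<mu> - \<nu>) * ?J z)"
        by (rule integral_cong) (use eq in auto)
      also have "\<dots> = integral {0..x} (A \<mu> ?d) + integral {0..x} (\<lambda>z. (\<mu> - \<nu>) * ?J z)"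
        by (rule integral_add) (use i J' in auto)
      finally have e: "?d x = integral {0..x} (A \<mu> ?d) + integral {0..x} (\<lambda>z. (\<mu> - \<nu>) * ?J z)" .
      have "norm (integral {0..x} (\<lambda>z. (\<mu> - \<nu>) * ?J z)) \<le> integral {0..x} (\<lambda>z. \<bar>\<mu> - \<nu>\<bar> * (C * B * R))"
      proof (rule integral_norm_bound_integral[OF J' integrable_const_ivl])
        fix z assume "z \<in> {0..x}"
        then have "\<bar>?J z\<bar> \<le> C * B * R" using x by (intro J) auto
        then show "norm ((\<mu> - \<nu>) * ?J z) \<le> \<bar>\<mu> - \<nu>\<bar> * (C * B * R)"
          unfolding real_norm_def abs_mult by (rule mult_left_mono) simp
      qed
      also have "\<dots> = \<bar>\<mu> - \<nu>\<bar> * (C * B * R) * x" using x by simp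
      also have "\<dots> \<le> \<bar>\<mu> - \<nu>\<bar> * (C * B * R) * R" using x C B(1) R by (intro mult_left_mono) auto
      also have "\<dots> = E * \<bar>\<mu> - \<nu>\<bar>" by (simp add: E_def)
      finally show "\<bar>?d x\<bar> \<le> E * \<bar>\<mu> - \<nu>\<bar> + \<bar>integral {0..x} (A \<mu> ?d)\<bar>" using e by simp
    qed
    also have "\<dots> \<le> 2 * (E * \<bar>\<mu> - \<nu>\<bar>) * exp ((2 * (K \<Lambda> * R) + 1) * R)"
    proof -
      have "K \<mu> \<le> K \<Lambda>" using \<mu> C by (auto simp: K_def intro!: mult_right_mono)
      then have "(2 * (K \<mu> * R) + 1) * R \<le> (2 * (K \<Lambda> * R) + 1) * R"
        using R by (intro mult_right_mono add_right_mono mult_left_mono) auto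
      then show ?thesis using E0 by (intro mult_left_mono) auto
    qed
    finally show ?thesis by (simp add: mult_ac)
  qed
  then show ?thesis by blast
qed

lemma V_lipschitz:
  assumes \<Lambda>: "0 \<le> \<Lambda>"
  shows "\<exists>L. \<forall>\<mu>\<in>{0..\<Lambda>}. \<bar>V \<mu> R - V \<nu> R\<bar> \<le> L * \<bar>\<mu> - \<nu>\<bar>"
proof -
  obtain B where B: "0 \<le> B" "\<And>y. y \<in> {0..R} \<Longrightarrow> \<bar>\<xi> \<nu> y\<bar> \<le> B" using \<xi>_bounded by blast
  obtain L where L: "\<And>\<mu> y. \<mu> \<in> {0..\<Lambda>} \<Longrightarrow> y \<in> {0..R} \<Longrightarrow> \<bar>\<xi> \<mu> y - \<xi> \<nu> y\<bar> \<le> L * \<bar>\<mu> - \<nu>\<bar>"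
    using \<xi>_lipschitz[OF \<Lambda>] by blast
  have pR: "0 < p R" using p_pos R by simp
  define L' where "L' = (K \<Lambda> * p R * L + C * p R * B) * R"
  have "\<bar>V \<mu> R - V \<nu> R\<bar> \<le> L' * \<bar>\<mu> - \<nu>\<bar>" if \<mu>: "\<mu> \<in> {0..\<Lambda>}" for \<mu>
  proof -
    have "V \<mu> R - V \<nu> R = integral {0..R} (\<lambda>z. q \<mu> z * \<xi> \<mu> z - q \<nu> z * \<xi> \<nu> z)"
      unfolding V_def
      by (rule integral_diff[symmetric]) (intro integrable_continuous_real continuous_intros q_cont \<xi>(1))+
    also have "\<bar>\<dots>\<bar> \<le> ((K \<Lambda> * p R * L + C * p R * B) * \<bar>\<mu> - \<nu>\<bar>) * R"
    proof (rule integral_bound_initial)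
      show "continuous_on {0..R} (\<lambda>z. q \<mu> z * \<xi> \<mu> z - q \<nu> z * \<xi> \<nu> z)"
        by (intro continuous_intros q_cont \<xi>(1))
      fix z assume z: "z \<in> {0..R}"
      have "K \<mu> \<le> K \<Lambda>" using \<mu> C by (auto simp: K_def intro!: mult_right_mono)
      then have "K \<mu> * p R \<le> K \<Lambda> * p R" using pR by (intro mult_right_mono) auto
      then have "\<bar>q \<mu> z\<bar> \<le> K \<Lambda> * p R"
        using q_le[of z R \<mu>] z by auto
      then have 1: "\<bar>q \<mu> z\<bar> * \<bar>\<xi> \<mu> z - \<xi> \<nu> z\<bar> \<le> (K \<Lambda> * p R) * (L * \<bar>\<mu> - \<nu>\<bar>)"
        using L[OF \<mu> z] K_nonneg[of \<Lambda>] pR by (intro mult_mono) auto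
      have 2: "\<alpha> z * \<bar>\<xi> \<nu> z\<bar> \<le> (C * p R) * B"
        using \<alpha>_le[of z R] B(2)[OF z] \<alpha>_nonneg[OF z] z pR C by (intro mult_mono) auto
      have "q \<mu> z * \<xi> \<mu> z - q \<nu> z * \<xi> \<nu> z = q \<mu> z * (\<xi> \<mu> z - \<xi> \<nu> z) + (\<mu> - \<nu>) * (\<alpha> z * \<xi> \<nu> z)"
        by (simp add: q_def algebra_simps)
      then have "\<bar>q \<mu> z * \<xi> \<mu> z - q \<nu> z * \<xi> \<nu> z\<bar>
          \<le> \<bar>q \<mu> z\<bar> * \<bar>\<xi> \<mu> z - \<xi> \<nu> z\<bar> + \<bar>\<mu> - \<nu>\<bar> * (\<alpha> z * \<bar>\<xi> \<nu> z\<bar>)"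
        using abs_triangle_ineq[of "q \<mu> z * (\<xi> \<mu> z - \<xi> \<nu> z)" "(\<mu> - \<nu>) * (\<alpha> z * \<xi> \<nu> z)"] \<alpha>_nonneg[OF z]
        by (simp add: abs_mult)
      also have "\<dots> \<le> (K \<Lambda> * p R) * (L * \<bar>\<mu> - \<nu>\<bar>) + \<bar>\<mu> - \<nu>\<bar> * ((C * p R) * B)"
        by (intro add_mono 1 mult_left_mono 2) auto
      finally show "\<bar>q \<mu> z * \<xi> \<mu> z - q \<nu> z * \<xi> \<nu> z\<bar> \<le> (K \<Lambda> * p R * L + C * p R * B) * \<bar>\<mu> - \<nu>\<bar>"
        by (simp add: algebra_simps)
    qed (use R in auto)
    finally show ?thesis by (simp add: L'_def mult_ac)
  qed
  then show ?thesis by blast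
qed

text \<open>For \<open>\<mu> \<ge> C\<close> the coefficient \<open>q\<close> is nonnegative. Then
  \<open>V * \<xi>\<close> has derivative \<open>q * \<xi>\<^sup>2 + V\<^sup>2 / p \<ge> 0\<close>
  and starts at 0; hence \<open>\<xi>\<^sup>2\<close> is nondecreasing from 1 and
  \<open>\<xi>\<close> cannot reach zero.\<close>

lemma \<xi>_pos_large:
  assumes \<mu>: "C \<le> \<mu>" and y: "y \<in> {0..R}"
  shows "0 < \<xi> \<mu> y" "0 \<le> V \<mu> y"
proof -
  have q0: "0 \<le> q \<mu> z" if "z \<in> {0..R}" for z
    using \<beta>_le[OF that] mult_right_mono[OF \<mu> \<alpha>_nonneg[OF that]] by (simp add: q_def)
  have at: "at z within {0..R} = at z" if "0 < z" "z < R" for z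
    using that by (intro at_within_Icc_at)
  have V\<xi>: "0 \<le> V \<mu> x * \<xi> \<mu> x" if x: "x \<in> {0..R}" for x
  proof -
    have "V \<mu> 0 * \<xi> \<mu> 0 \<le> V \<mu> x * \<xi> \<mu> x"
    proof (rule DERIV_nonneg_imp_increasing_open[of 0 x "\<lambda>z. V \<mu> z * \<xi> \<mu> z"])
      fix z assume z: "0 < z" "z < x"
      have d: "(\<xi> \<mu> has_real_derivative V \<mu> z / p z) (at z)" "(V \<mu> has_real_derivative q \<mu> z * \<xi> \<mu> z) (at z)"
        using \<xi>_deriv[of z \<mu>] V_deriv[of z \<mu>] z x at[of z] by auto
      have "((\<lambda>z. V \<mu> z * \<xi> \<mu> z) has_real_derivative q \<mu> z * (\<xi> \<mu> z)\<^sup>2 + (V \<mu> z)\<^sup>2 / p z) (at z)"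
        by (auto intro!: derivative_eq_intros d simp: power2_eq_square)
      moreover have "0 \<le> q \<mu> z * (\<xi> \<mu> z)\<^sup>2 + (V \<mu> z)\<^sup>2 / p z"
        using q0[of z] p_pos[of z] z x by auto
      ultimately show "\<exists>D. ((\<lambda>z. V \<mu> z * \<xi> \<mu> z) has_real_derivative D) (at z) \<and> 0 \<le> D" by blast
    next
      show "continuous_on {0..x} (\<lambda>z. V \<mu> z * \<xi> \<mu> z)"
        using x by (intro continuous_intros continuous_on_subset[OF V_cont] continuous_on_subset[OF \<xi>(1)]) auto
    qed (use x in auto)
    then show ?thesis by (simp add: V_0)
  qed
  have sq: "1 \<le> (\<xi> \<mu> x)\<^sup>2" if x: "x \<in> {0..R}" for x
  proof -
    have "(\<xi> \<mu> 0)\<^sup>2 \<le> (\<xi> \<mu> x)\<^sup>2"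
    proof (rule DERIV_nonneg_imp_increasing_open[of 0 x "\<lambda>z. (\<xi> \<mu> z)\<^sup>2"])
      fix z assume z: "0 < z" "z < x"
      have d: "(\<xi> \<mu> has_real_derivative V \<mu> z / p z) (at z)"
        using \<xi>_deriv[of z \<mu>] z x at[of z] by auto
      have "((\<lambda>z. (\<xi> \<mu> z)\<^sup>2) has_real_derivative 2 * (V \<mu> z * \<xi> \<mu> z) / p z) (at z)"
        by (auto intro!: derivative_eq_intros d)
      moreover have "0 \<le> 2 * (V \<mu> z * \<xi> \<mu> z) / p z"
        using V\<xi>[of z] p_pos[of z] z x by auto
      ultimately show "\<exists>D. ((\<lambda>z. (\<xi> \<mu> z)\<^sup>2) has_real_derivative D) (at z) \<and> 0 \<le> D" by blast
    next
      show "continuous_on {0..x} (\<lambda>z. (\<xi> \<mu> z)\<^sup>2)"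
        using x by (intro continuous_intros continuous_on_subset[OF \<xi>(1)]) auto
    qed (use x in auto)
    then show ?thesis by (simp add: \<xi>_0)
  qed
  show pos: "0 < \<xi> \<mu> y"
  proof (rule ccontr)
    assume "\<not> 0 < \<xi> \<mu> y"
    then obtain z where "0 \<le> z" "z \<le> y" "\<xi> \<mu> z = 0"
      using IVT2'[of "\<xi> \<mu>" y 0 0] y \<xi>_0[of \<mu>] continuous_on_subset[OF \<xi>(1)[of \<mu>], of "{0..y}"] by auto
    then show False using sq[of z] y by auto
  qed
  show "0 \<le> V \<mu> y" using V\<xi>[OF y] pos by (simp add: zero_le_mult_iff)
qed

lemma \<xi>_double_zero:
  assumes "0 < y" "y \<le> R" "\<xi> \<mu> y = 0" "V \<mu> y = 0"
  shows False
proof -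
  have "\<xi> \<mu> 0 = 0"
    by (rule double_zero_propagates[where p=p and q="q \<mu>" and V="V \<mu>" and R=R and ?y1.0=y])
      (use assms cont p_pos q_cont \<xi>(1) \<xi>_deriv V_deriv in auto)
  then show False by (simp add: \<xi>_0)
qed

lemma \<xi>_interior_zero:
  assumes y: "0 < y" "y < R" "\<xi> \<mu> y = 0" and nonneg: "\<And>z. z \<in> {0..R} \<Longrightarrow> 0 \<le> \<xi> \<mu> z"
  shows False
proof -
  have "at y within {0..R} = at y" using y by (intro at_within_Icc_at) auto
  then have d: "(\<xi> \<mu> has_real_derivative V \<mu> y / p y) (at y)" using \<xi>_deriv[of y \<mu>] y by auto
  have "V \<mu> y / p y = 0"
    using nonneg y by (intro DERIV_local_min[OF d, of "min y (R - y)"]) (auto simp: abs_less_iff)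
  then have "V \<mu> y = 0" using p_pos[of y] y by auto
  then show False using \<xi>_double_zero[of y \<mu>] y by simp
qed

text \<open>The minimum of \<open>\<xi> \<mu>\<close> depends continuously on \<open>\<mu>\<close> and changes sign. Where it vanishes the zero must
  sit at \<open>R\<close>, as an interior one would be a double zero; there the boundary functional
  is nonpositive, while it is positive for large \<open>\<mu>\<close>.\<close>

theorem shooting:
  assumes y0: "0 < y0" "y0 < R" "\<xi> 0 y0 \<le> 0" and c: "0 < c"
  shows "\<exists>\<mu>>0. c * \<xi> \<mu> R + V \<mu> R = 0"
proof -
  define ym where "ym \<mu> = (SOME y. y \<in> {0..R} \<and> (\<forall>z\<in>{0..R}. \<xi> \<mu> y \<le> \<xi> \<mu> z))" for \<mu>
  define m where "m \<mu> = \<xi> \<mu> (ym \<mu>)" for \<mu>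
  have "\<exists>y\<in>{0..R}. \<forall>z\<in>{0..R}. \<xi> \<mu> y \<le> \<xi> \<mu> z" for \<mu>
    using R by (intro continuous_attains_inf compact_Icc \<xi>(1)) auto
  then have "\<exists>y. y \<in> {0..R} \<and> (\<forall>z\<in>{0..R}. \<xi> \<mu> y \<le> \<xi> \<mu> z)" for \<mu> by blast
  from someI_ex[OF this] have ym: "ym \<mu> \<in> {0..R}" "z \<in> {0..R} \<Longrightarrow> m \<mu> \<le> \<xi> \<mu> z" for \<mu> z
    unfolding m_def ym_def by blast+
  have mL: "continuous_on {0..C} m"
  proof (rule continuous_on_of_lipschitz_at)
    fix \<nu>
    obtain L where L: "\<And>\<mu> y. \<mu> \<in> {0..C} \<Longrightarrow> y \<in> {0..R} \<Longrightarrow> \<bar>\<xi> \<mu> y - \<xi> \<nu> y\<bar> \<le> L * \<bar>\<mu> - \<nu>\<bar>"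
      using \<xi>_lipschitz[OF C] by blast
    have "\<bar>m \<mu> - m \<nu>\<bar> \<le> L * \<bar>\<mu> - \<nu>\<bar>" if "\<mu> \<in> {0..C}" for \<mu>
      using L[OF that ym(1)[of \<mu>]] L[OF that ym(1)[of \<nu>]] ym(2)[OF ym(1)[of \<mu>], of \<nu>] ym(2)[OF ym(1)[of \<nu>], of \<mu>]
      unfolding m_def by linarith
    then show "\<exists>L. \<forall>\<mu>\<in>{0..C}. \<bar>m \<mu> - m \<nu>\<bar> \<le> L * \<bar>\<mu> - \<nu>\<bar>" by blast
  qed
  \<comment> \<open>Strict although only \<open>\<xi> 0 y0 \<le> 0\<close> is given: a solution that
    merely touches zero inside would have a double zero.\<close>
  have "m 0 < 0"
  proof (rule ccontr)
    assume "\<not> m 0 < 0"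
    then have "0 \<le> \<xi> 0 z" if "z \<in> {0..R}" for z using ym(2)[OF that, of 0] by simp
    moreover from this[of y0] have "\<xi> 0 y0 = 0" using y0 by auto
    ultimately show False using \<xi>_interior_zero[of y0 0] y0 by blast
  qed
  moreover have "0 < m C" unfolding m_def by (rule \<xi>_pos_large[OF order_refl ym(1)])
  ultimately obtain \<mu>1 where \<mu>1: "0 \<le> \<mu>1" "\<mu>1 \<le> C" "m \<mu>1 = 0"
    using IVT'[of m 0 0 C] C mL by auto
  with \<open>m 0 < 0\<close> have \<mu>1_pos: "0 < \<mu>1" by (cases "\<mu>1 = 0") auto
  have nonneg: "0 \<le> \<xi> \<mu>1 z" if "z \<in> {0..R}" for z using ym(2)[OF that, of \<mu>1] \<mu>1 by simp
  have "ym \<mu>1 \<noteq> 0" using \<xi>_0[of \<mu>1] \<mu>1 by (auto simp: m_def)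
  then have "ym \<mu>1 = R"
    using \<xi>_interior_zero[of "ym \<mu>1" \<mu>1, OF _ _ _ nonneg] \<mu>1(3) ym(1)[of \<mu>1] unfolding m_def by force
  then have \<xi>R: "\<xi> \<mu>1 R = 0" using \<mu>1 by (simp add: m_def)
  \<comment> \<open>A positive flux at \<open>R\<close> would make \<open>\<xi> \<mu>1\<close>,
    which vanishes at \<open>R\<close>, negative just before it.\<close>
  have "V \<mu>1 R \<le> 0"
  proof (rule ccontr)
    assume "\<not> V \<mu>1 R \<le> 0"
    then have "0 < V \<mu>1 R / p R" using p_pos[of R] R by simp
    then obtain e where e: "e > 0" "\<And>h. h > 0 \<Longrightarrow> R - h \<in> {0..R} \<Longrightarrow> h < e \<Longrightarrow> \<xi> \<mu>1 (R - h) < \<xi> \<mu>1 R"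
      using has_real_derivative_pos_inc_left[OF \<xi>_deriv[of R \<mu>1]] R by auto
    define h where "h = min (e / 2) R"
    have "\<xi> \<mu>1 (R - h) < 0" using e(2)[of h] e(1) R \<xi>R by (auto simp: h_def)
    then show False using nonneg[of "R - h"] e(1) R by (auto simp: h_def)
  qed
  then have F1: "c * \<xi> \<mu>1 R + V \<mu>1 R \<le> 0" by (simp add: \<xi>R)
  have F2: "0 \<le> c * \<xi> C R + V C R"
    using \<xi>_pos_large[of C R] R c by auto
  have "continuous_on {0..C} (\<lambda>\<mu>. \<xi> \<mu> R)"
  proof (rule continuous_on_of_lipschitz_at)
    fix \<nu>
    have "R \<in> {0..R}" using R by simp
    then show "\<exists>L. \<forall>\<mu>\<in>{0..C}. \<bar>\<xi> \<mu> R - \<xi> \<nu> R\<bar> \<le> L * \<bar>\<mu> - \<nu>\<bar>"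
      using \<xi>_lipschitz[OF C, of \<nu>] by blast
  qed
  moreover have "continuous_on {0..C} (\<lambda>\<mu>. V \<mu> R)"
    using V_lipschitz[OF C] by (intro continuous_on_of_lipschitz_at) blast
  ultimately have "continuous_on {\<mu>1..C} (\<lambda>\<mu>. c * \<xi> \<mu> R + V \<mu> R)"
    using \<mu>1 by (intro continuous_intros) (auto elim!: continuous_on_subset)
  then obtain \<mu> where "\<mu>1 \<le> \<mu>" "c * \<xi> \<mu> R + V \<mu> R = 0"
    using IVT'[OF F1 F2 \<mu>1(2)] by blast
  then show ?thesis using \<mu>1_pos by (intro exI[of _ \<mu>]) auto
qed

end

section \<open>Radial Sobolev functions\<close>

text \<open>By translation invariance of Lebesgue measure every difference quotient of
  \<open>f\<close> integrates to zero; dominated convergence carries this over to the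
  derivative.\<close>

lemma integral_inner_gradient_eq_0:
  fixes f :: "'a::euclidean_space \<Rightarrow> real" and D :: "'a \<Rightarrow> 'a"
  assumes deriv: "\<And>x. (f has_derivative (\<lambda>h. D x \<bullet> h)) (at x)"
    and cont: "continuous_on UNIV D"
    and f0: "\<And>x. r < norm x \<Longrightarrow> f x = 0" and D0: "\<And>x. r < norm x \<Longrightarrow> D x = 0"
  shows "integral\<^sup>L lborel (\<lambda>x. D x \<bullet> i) = 0"
proof -
  have fcont: "continuous_on UNIV f"
    using deriv has_derivative_continuous by (metis continuous_at_imp_continuous_on)
  have fmeas [measurable]: "f \<in> borel_measurable borel"
    by (rule borel_measurable_continuous_onI[OF fcont])
  have Dmeas [measurable]: "D \<in> borel_measurable borel"
    by (rule borel_measurable_continuous_onI[OF cont])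
  obtain B where B: "\<And>x. x \<in> cball 0 r \<Longrightarrow> norm (D x) \<le> B"
    using compact_imp_bounded[OF compact_continuous_image[OF continuous_on_subset[OF cont] compact_cball]]
    by (metis UNIV_I bounded_iff imageI subsetI)
  define B' where "B' = max B 0"
  have B': "norm (D x) \<le> B'" for x
    using B[of x] D0[of x] by (cases "norm x \<le> r") (auto simp: B'_def)
  have fint: "integrable lborel f"
  proof -
    have "integrable lborel (\<lambda>x. indicator (cball 0 r) x *\<^sub>R f x)"
      by (rule borel_integrable_compact) (auto intro: continuous_on_subset[OF fcont])
    moreover have "(\<lambda>x. indicator (cball 0 r) x *\<^sub>R f x) = f"
      using f0 by (auto simp: indicator_def fun_eq_iff not_le)
    ultimately show ?thesis by simp
  qed
  have shift: "integrable lborel (\<lambda>x. f (c + x))" "integral\<^sup>L lborel (\<lambda>x. f (c + x)) = integral\<^sup>L lborel f" for c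
  proof -
    have "integrable (distr lborel borel ((+) c)) f" by (simp add: lborel_distr_plus fint)
    then show "integrable lborel (\<lambda>x. f (c + x))"
      by (subst (asm) integrable_distr_eq) auto
    have "integral\<^sup>L (distr lborel borel ((+) c)) f = integral\<^sup>L lborel (\<lambda>x. f (c + x))"
      by (subst integral_distr) auto
    then show "integral\<^sup>L lborel (\<lambda>x. f (c + x)) = integral\<^sup>L lborel f"
      by (simp add: lborel_distr_plus)
  qed
  \<comment> \<open>Steps of size at most 1 keep all difference quotients supported in the ball of
    radius \<open>r + norm i\<close>, whose indicator times the Lipschitz bound
    \<open>B' * norm i\<close> dominates them.\<close>
  define h where "h n = 1 / (real n + 1)" for n
  have h: "0 < h n" "h n \<le> 1" for n by (auto simp: h_def divide_simps)
  define F where "F n x = (f (h n *\<^sub>R i + x) - f x) / h n" for n x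
  have lip: "\<bar>f (c + x) - f x\<bar> \<le> B' * norm c" for c x
  proof -
    have "norm (f (c + x) - f x) \<le> B' * norm ((c + x) - x)"
    proof (rule differentiable_bound[of UNIV f "\<lambda>x h. D x \<bullet> h"])
      show "onorm ((\<bullet>) (D x)) \<le> B'" for x
      proof (rule onorm_bound)
        show "norm (D x \<bullet> y) \<le> B' * norm y" for y
          by (metis B' Cauchy_Schwarz_ineq2 mult_right_mono norm_ge_zero order_trans real_norm_def)
        show "0 \<le> B'" by (simp add: B'_def)
      qed
    qed (use deriv has_derivative_at_withinI in auto)
    then show ?thesis by simp
  qed
  have "(\<lambda>n. integral\<^sup>L lborel (F n)) \<longlonglongrightarrow> integral\<^sup>L lborel (\<lambda>x. D x \<bullet> i)"
  proof (rule integral_dominated_convergence)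
    show "(\<lambda>x. D x \<bullet> i) \<in> borel_measurable lborel" by simp
    show "F n \<in> borel_measurable lborel" for n unfolding F_def by measurable
    have "integrable lborel (indicator (cball (0::'a) (r + norm i)) :: 'a \<Rightarrow> real)"
      using emeasure_lborel_cball_finite[of "0::'a" "r + norm i"]
      by (intro integrable_real_indicator) auto
    then show "integrable lborel (\<lambda>x. B' * norm i * indicator (cball (0::'a) (r + norm i)) x)"
      by simp
    show "AE x in lborel. (\<lambda>n. F n x) \<longlonglongrightarrow> D x \<bullet> i"
    proof (rule AE_I2)
      fix x
      have "((\<lambda>t. f (t *\<^sub>R i + x)) has_derivative (\<lambda>t. D x \<bullet> (t *\<^sub>R i))) (at 0)"
        by (rule has_derivative_compose[where g=f and f="\<lambda>t. t *\<^sub>R i + x" and s=UNIV, simplified])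
           (auto intro!: derivative_eq_intros deriv)
      then have "((\<lambda>t. f (t *\<^sub>R i + x)) has_field_derivative (D x \<bullet> i)) (at 0)"
        by (simp add: has_field_derivative_def mult.commute[of _ "D x \<bullet> i"] has_derivative_eq_rhs)
      then have "((\<lambda>t. (f (t *\<^sub>R i + x) - f x) / t) \<longlongrightarrow> D x \<bullet> i) (at 0)"
        by (simp add: DERIV_def)
      moreover have "filterlim h (at 0) sequentially"
        unfolding filterlim_at
      proof
        show "\<forall>\<^sub>F n in sequentially. h n \<in> UNIV \<and> h n \<noteq> 0"
          using h(1) by (auto intro!: always_eventually simp: less_imp_neq[THEN not_sym])
        show "h \<longlonglongrightarrow> 0"
          unfolding h_def using LIMSEQ_inverse_real_of_nat by (simp add: inverse_eq_divide add.commute)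
      qed
      ultimately show "(\<lambda>n. F n x) \<longlonglongrightarrow> D x \<bullet> i"
        unfolding F_def by (rule filterlim_compose)
    qed
    show "AE x in lborel. norm (F n x) \<le> B' * norm i * indicator (cball (0::'a) (r + norm i)) x" for n
    proof (rule AE_I2)
      fix x
      show "norm (F n x) \<le> B' * norm i * indicator (cball (0::'a) (r + norm i)) x"
      proof (cases "norm x \<le> r + norm i")
        case True
        have "\<bar>f (h n *\<^sub>R i + x) - f x\<bar> \<le> B' * norm i * h n"
          using lip[of "h n *\<^sub>R i" x] h(1)[of n] by (simp add: mult_ac)
        then show ?thesis using True h(1)[of n] by (simp add: F_def divide_simps)
      next
        case False
        have "norm x \<le> norm (h n *\<^sub>R i + x) + norm (h n *\<^sub>R i)"
          by (metis add.commute norm_triangle_sub add_diff_cancel_right' norm_minus_commute norm_triangle_ineq4)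
        moreover have "norm (h n *\<^sub>R i) \<le> norm i"
          using h[of n] by (simp add: mult_left_le_one_le)
        ultimately have "r < norm (h n *\<^sub>R i + x)" using False by linarith
        moreover have "r < norm x" using False norm_ge_zero[of i] by linarith
        ultimately show ?thesis using False by (simp add: F_def f0)
      qed
    qed
  qed
  moreover have "integral\<^sup>L lborel (F n) = 0" for n
  proof -
    have "integral\<^sup>L lborel (F n) = (integral\<^sup>L lborel (\<lambda>x. f (h n *\<^sub>R i + x)) - integral\<^sup>L lborel f) / h n"
      unfolding F_def using shift(1) fint by simp
    then show ?thesis by (simp add: shift(2))
  qed
  ultimately show ?thesis by (simp add: LIMSEQ_const_iff)
qed

lemma H1_cong:
  fixes S :: "'a::euclidean_space set"
  assumes eq: "\<And>x. x \<in> S \<Longrightarrow> u x = v x" and "S \<in> sets lebesgue" and "H1 S v"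
  shows "H1 S u"
proof -
  have sp: "space (lebesgue_on S) = S" by simp
  have m: "u \<in> borel_measurable (lebesgue_on S) \<longleftrightarrow> v \<in> borel_measurable (lebesgue_on S)"
    by (rule measurable_cong) (simp add: eq)
  have i: "integrable (lebesgue_on S) (\<lambda>x. (u x)\<^sup>2) \<longleftrightarrow> integrable (lebesgue_on S) (\<lambda>x. (v x)\<^sup>2)"
    by (rule Bochner_Integration.integrable_cong) (simp_all add: eq)
  have e: "integral\<^sup>L (lebesgue_on S) (\<lambda>x. u x * F x) = integral\<^sup>L (lebesgue_on S) (\<lambda>x. v x * F x)" for F
    by (rule Bochner_Integration.integral_cong) (simp_all add: eq)
  show ?thesis using assms(3) unfolding H1_def m i e .
qed

lemma integrable_lebesgue_on_ball_continuous:
  fixes f :: "'a::euclidean_space \<Rightarrow> real"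
  assumes "continuous_on UNIV f"
  shows "integrable (lebesgue_on (ball 0 R)) f"
proof -
  have "integrable lborel (\<lambda>x. indicator (cball 0 R) x *\<^sub>R f x)"
    by (rule borel_integrable_compact) (auto intro: continuous_on_subset[OF assms])
  then have "integrable (lebesgue_on (cball 0 R)) f"
    by (simp add: integrable_restrict_space integrable_completion set_integrable_def)
  then have "set_integrable lebesgue (cball 0 R) f"
    by (simp add: integrable_restrict_space set_integrable_def)
  then have "set_integrable lebesgue (ball 0 R) f"
    by (rule set_integrable_subset) auto
  then show ?thesis
    by (simp add: integrable_restrict_space set_integrable_def)
qed

lemma lebesgue_on_ball_integral_eq_lborel:
  fixes f :: "'a::euclidean_space \<Rightarrow> real"
  assumes "continuous_on UNIV f" "\<And>x. x \<notin> ball 0 R \<Longrightarrow> f x = 0"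
  shows "integral\<^sup>L (lebesgue_on (ball 0 R)) f = integral\<^sup>L lborel f"
proof -
  have [measurable]: "f \<in> borel_measurable borel"
    by (rule borel_measurable_continuous_onI) (rule assms(1))
  have "integral\<^sup>L (lebesgue_on (ball 0 R)) f = integral\<^sup>L lebesgue (\<lambda>x. indicator (ball 0 R) x *\<^sub>R f x)"
    by (rule integral_restrict_space) simp
  also have "(\<lambda>x. indicator (ball 0 R) x *\<^sub>R f x) = f"
    using assms(2) by (auto simp: indicator_def fun_eq_iff)
  also have "integral\<^sup>L lebesgue f = integral\<^sup>L lborel f"
    by (rule integral_completion) simp
  finally show ?thesis .
qed

text \<open>\<open>u\<close> is differentiable only inside the ball, but a test function vanishes
  near every point outside, so \<open>u * \<phi>\<close> is C1 on the whole space with compact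
  support. Integration by parts is then the vanishing of the integral of its gradient.\<close>

lemma H1_ball_of_C1:
  fixes u :: "'a::euclidean_space \<Rightarrow> real" and G :: "'a \<Rightarrow> 'a"
  assumes u: "continuous_on UNIV u" and G: "continuous_on UNIV G"
    and deriv: "\<And>x. x \<in> ball 0 R \<Longrightarrow> (u has_derivative (\<lambda>h. G x \<bullet> h)) (at x)"
  shows "H1 (ball 0 R) u"
proof -
  have meas: "f \<in> borel_measurable (lebesgue_on (ball 0 R))" if "continuous_on UNIV f"
    for f :: "'a \<Rightarrow> 'c::euclidean_space"
    by (rule continuous_imp_measurable_on_sets_lebesgue) (use that continuous_on_subset in auto)
  have "integral\<^sup>L (lebesgue_on (ball 0 R)) (\<lambda>x. u x * (D\<phi> x \<bullet> i)) =
        - integral\<^sup>L (lebesgue_on (ball 0 R)) (\<lambda>x. (G x \<bullet> i) * \<phi> x)"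
    if "test_fn (ball 0 R) \<phi> D\<phi>" for \<phi> D\<phi> i
  proof -
    let ?K = "closure {x. \<phi> x \<noteq> 0}"
    have D\<phi>c: "continuous_on UNIV D\<phi>" and d\<phi>: "\<And>x. (\<phi> has_derivative (\<lambda>h. D\<phi> x \<bullet> h)) (at x)"
      and K: "?K \<subseteq> ball 0 R"
      using that by (auto simp: test_fn_def)
    have \<phi>c: "continuous_on UNIV \<phi>"
      using d\<phi> has_derivative_continuous by (metis continuous_at_imp_continuous_on)
    have \<phi>0: "\<phi> x = 0" if "x \<notin> ?K" for x
      using that subsetD[OF closure_subset, of x "{x. \<phi> x \<noteq> 0}"] by blast
    have ev: "\<forall>\<^sub>F y in nhds x. \<phi> y = 0" if "x \<notin> ?K" for x
    proof -
      have "\<forall>\<^sub>F y in nhds x. y \<in> - ?K"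
        by (rule eventually_nhds_in_open) (use that in \<open>simp_all add: open_Compl\<close>)
      then show ?thesis by eventually_elim (rule \<phi>0, simp)
    qed
    have D0: "D\<phi> x = 0" if "x \<notin> ?K" for x
    proof -
      have "(\<phi> has_derivative (\<lambda>h. 0)) (at x)"
        by (rule has_derivative_transform_eventually[of "\<lambda>_. 0"])
           (use ev[OF that] in \<open>auto simp: eventually_at_filter \<phi>0[OF that] elim!: eventually_mono\<close>)
      then have "(\<lambda>h. D\<phi> x \<bullet> h) = (\<lambda>h. 0)" by (rule has_derivative_unique[OF d\<phi>])
      then show ?thesis by (metis inner_eq_zero_iff)
    qed
    let ?D = "\<lambda>x. u x *\<^sub>R D\<phi> x + \<phi> x *\<^sub>R G x"
    have "integral\<^sup>L lborel (\<lambda>x. ?D x \<bullet> i) = 0"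
    proof (rule integral_inner_gradient_eq_0[where f="\<lambda>x. u x * \<phi> x" and r=R])
      fix x
      show "((\<lambda>x. u x * \<phi> x) has_derivative (\<lambda>h. ?D x \<bullet> h)) (at x)"
      proof (cases "x \<in> ball 0 R")
        case True
        then show ?thesis
          by (auto intro!: derivative_eq_intros deriv d\<phi> simp: inner_add_left algebra_simps)
      next
        case False
        then have x: "x \<notin> ?K" using K by auto
        have "((\<lambda>x. u x * \<phi> x) has_derivative (\<lambda>h. 0)) (at x)"
          by (rule has_derivative_transform_eventually[of "\<lambda>_. 0"])
             (use ev[OF x] in \<open>auto simp: eventually_at_filter \<phi>0[OF x] elim!: eventually_mono\<close>)
        then show ?thesis by (simp add: D0[OF x] \<phi>0[OF x])
      qed
    next
      show "continuous_on UNIV ?D"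
        by (intro continuous_intros u G \<phi>c D\<phi>c)
    next
      fix x :: 'a assume "R < norm x"
      then have "x \<notin> ?K" using K by auto
      then have "\<phi> x = 0" "D\<phi> x = 0" by (fact \<phi>0, fact D0)
      then show "u x * \<phi> x = 0" "?D x = 0" by simp_all
    qed
    then have "integral\<^sup>L lborel (\<lambda>x. u x * (D\<phi> x \<bullet> i) + (G x \<bullet> i) * \<phi> x) = 0"
      by (simp add: inner_add_left mult.commute)
    moreover have "integral\<^sup>L (lebesgue_on (ball 0 R)) (\<lambda>x. u x * (D\<phi> x \<bullet> i) + (G x \<bullet> i) * \<phi> x)
        = integral\<^sup>L lborel (\<lambda>x. u x * (D\<phi> x \<bullet> i) + (G x \<bullet> i) * \<phi> x)"
    proof (rule lebesgue_on_ball_integral_eq_lborel)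
      show "continuous_on UNIV (\<lambda>x. u x * (D\<phi> x \<bullet> i) + (G x \<bullet> i) * \<phi> x)"
        by (intro continuous_intros u G \<phi>c D\<phi>c)
      show "u x * (D\<phi> x \<bullet> i) + (G x \<bullet> i) * \<phi> x = 0" if "x \<notin> ball 0 R" for x
      proof -
        have "x \<notin> ?K" using that K by auto
        then have "\<phi> x = 0" "D\<phi> x = 0" by (fact \<phi>0, fact D0)
        then show ?thesis by simp
      qed
    qed
    moreover have "integrable (lebesgue_on (ball 0 R)) (\<lambda>x. u x * (D\<phi> x \<bullet> i))"
      "integrable (lebesgue_on (ball 0 R)) (\<lambda>x. (G x \<bullet> i) * \<phi> x)"
      by (intro integrable_lebesgue_on_ball_continuous continuous_intros u G \<phi>c D\<phi>c)+
    ultimately show ?thesis by simp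
  qed
  moreover have "integrable (lebesgue_on (ball 0 R)) (\<lambda>x. (u x)\<^sup>2)"
    "integrable (lebesgue_on (ball 0 R)) (\<lambda>x. (norm (G x))\<^sup>2)"
    by (intro integrable_lebesgue_on_ball_continuous continuous_intros u G)+
  ultimately show ?thesis
    unfolding H1_def using meas[OF u] meas[OF G] by blast
qed

text \<open>\<open>w' 0 = 0\<close> makes the radial extension differentiable at the origin with
  continuous gradient. Beyond radius \<open>R\<close> the function is continued by its boundary
  value, which gives a globally continuous \<open>u\<close>.\<close>

lemma H1r_of_C1:
  fixes w w' :: "real \<Rightarrow> real"
  assumes R: "0 < R" and w': "continuous_on {0..R} w'" "w' 0 = 0"
    and deriv: "\<And>y. y \<in> {0..R} \<Longrightarrow> (w has_real_derivative w' y) (at y within {0..R})"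
  shows "H1r TYPE('a::euclidean_space) R w"
proof -
  have w: "continuous_on {0..R} w"
    using deriv DERIV_continuous_on by blast
  define u where "u x = w (min R (norm x))" for x :: 'a
  define G where "G x = w' (min R (norm x)) *\<^sub>R sgn x" for x :: 'a
  have "continuous_on UNIV u" unfolding u_def
    by (rule continuous_on_compose2[OF w]) (use R in \<open>auto intro!: continuous_intros\<close>)
  moreover have cG: "continuous_on UNIV (\<lambda>x::'a. w' (min R (norm x)))"
    by (rule continuous_on_compose2[OF w'(1)]) (use R in \<open>auto intro!: continuous_intros\<close>)
  have "isCont G x" for x
  proof (cases "x = 0")
    case True
    have "isCont (\<lambda>x::'a. w' (min R (norm x))) 0"
      using cG by (simp add: continuous_on_eq_continuous_at)
    then have "((\<lambda>x::'a. w' (min R (norm x))) \<longlongrightarrow> 0) (at 0)"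
      using R w'(2) by (simp add: isCont_def min_def)
    then have "((\<lambda>x. norm (w' (min R (norm x)))) \<longlongrightarrow> 0) (at (0::'a))"
      by (rule tendsto_norm_zero)
    then have "(G \<longlongrightarrow> 0) (at 0)"
      by (rule Lim_null_comparison[rotated]) (auto simp: G_def norm_sgn)
    then show ?thesis using True by (simp add: isCont_def G_def)
  next
    case False
    then show ?thesis unfolding G_def
      using cG by (auto intro!: continuous_intros simp: continuous_on_eq_continuous_at)
  qed
  then have "continuous_on UNIV G" by (simp add: continuous_on_eq_continuous_at)
  moreover have "(u has_derivative (\<lambda>h. G x \<bullet> h)) (at x)" if "x \<in> ball 0 R" for x
  proof -
    have "\<forall>\<^sub>F y in at x. y \<in> ball 0 R"
      using that by (intro eventually_at_in_open') auto
    then have ev: "\<forall>\<^sub>F y in at x. w (norm y) = u y"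
      by eventually_elim (simp add: u_def min_def)
    have "((\<lambda>y. w (norm y)) has_derivative (\<lambda>h. G x \<bullet> h)) (at x)"
    proof (cases "x = 0")
      case False
      then have "0 < norm x" "norm x < R" using that by auto
      then have "(w has_real_derivative w' (norm x)) (at (norm x))"
        using deriv[of "norm x"] by (simp add: at_within_Icc_at)
      then have "((\<lambda>y. w (norm y)) has_derivative (\<lambda>h. w' (norm x) * (sgn x \<bullet> h))) (at x)"
        using has_derivative_compose[OF has_derivative_norm[OF False], of w "(*) (w' (norm x))"]
        by (simp add: has_field_derivative_def inner_commute)
      then show ?thesis using that by (simp add: G_def min_def)
    next
      case True
      have "((\<lambda>t. (w t - w 0) / (t - 0)) \<longlongrightarrow> 0) (at 0 within {0..R})"
        using deriv[of 0] R w'(2) by (simp add: has_field_derivative_iff)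
      moreover have "filterlim (norm :: 'a \<Rightarrow> real) (at 0 within {0..R}) (at 0)"
        unfolding filterlim_at
      proof
        show "\<forall>\<^sub>F x in at (0::'a). norm x \<in> {0..R} \<and> norm x \<noteq> 0"
          unfolding eventually_at using R by (intro exI[of _ R]) (simp add: dist_norm)
        show "((norm :: 'a \<Rightarrow> real) \<longlongrightarrow> 0) (at 0)"
          by (rule tendsto_norm_zero) (rule tendsto_ident_at)
      qed
      ultimately have "((\<lambda>y::'a. (w (norm y) - w 0) / (norm y - 0)) \<longlongrightarrow> 0) (at 0)"
        by (rule filterlim_compose)
      from tendsto_norm_zero[OF this]
      have "((\<lambda>y. w (norm y)) has_derivative (\<lambda>h. 0)) (at (0::'a))"
        unfolding has_derivative_at by simp
      then show ?thesis using True by (simp add: G_def)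
    qed
    then show ?thesis
      by (rule has_derivative_transform_eventually[OF _ ev]) (use that in \<open>auto simp: u_def\<close>)
  qed
  ultimately have "H1 (ball 0 R) u" by (rule H1_ball_of_C1)
  then show ?thesis unfolding H1r_def
    by (rule H1_cong[rotated 2]) (auto simp: u_def)
qed

section \<open>The Emden phase plane\<close>

text \<open>The linearisation at the fixed point of the phase plane is a spiral exactly when this
  inequality holds; with \<open>e = d - 2\<close> and \<open>x = A - 2\<close> it is where \<open>d < 10\<close> enters.\<close>

lemma discriminant_pos:
  fixes d A :: real
  assumes d: "3 \<le> d" "d < 10" and A: "2 \<le> A" "2 * A < d + 2"
  shows "(d - 2)\<^sup>2 < 4 * A * (d - A)"
proof -
  define x where "x = A - 2"
  define e where "e = d - 2"
  have "0 < (e - 2 * x) * (8 - e)"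
    using d A by (intro mult_pos_pos) (auto simp: x_def e_def)
  moreover have "0 \<le> x * (e / 2 - x)"
    using d A by (intro mult_nonneg_nonneg) (auto simp: x_def e_def)
  moreover have "0 \<le> x" using A by (simp add: x_def)
  moreover have "4 * A * (d - A) - (d - 2)\<^sup>2 = (e - 2 * x) * (8 - e) + 8 * x + 4 * (x * (e / 2 - x))"
    by (simp add: x_def e_def power2_eq_square field_simps)
  ultimately show ?thesis by linarith
qed

text \<open>Beyond \<open>2 * A = d + 2\<close> the form may be indefinite, but its null directions then lie outside
  the sector \<open>W \<ge> - P\<close>, which is why the sector condition is part of the statement.\<close>

lemma angular_form_coercive:
  fixes d A :: real
  assumes d: "3 \<le> d" "d < 10" and A: "2 \<le> A" "A < d"
  shows "\<exists>m>0. \<exists>\<epsilon>>0. \<forall>P>0. \<forall>W\<ge>-P.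
    m * (P\<^sup>2 + W\<^sup>2) \<le> (A - 2 * \<epsilon>) * P\<^sup>2 + (d - 2) * P * W + (d - A) * W\<^sup>2"
proof (cases "2 * A < d + 2")
  case True
  define G where "G = d - A"
  define b where "b = d - 2"
  \<comment> \<open>Chosen to make \<open>eq\<close> true: since \<open>A + G = d\<close>, lowering
    both diagonal entries by \<open>\<delta>\<close> costs \<open>4 * d * \<delta>\<close> in the
    discriminant, exactly its surplus, and leaves \<open>4 * \<delta>\<^sup>2\<close>.\<close>
  define \<delta> where "\<delta> = (4 * A * G - b\<^sup>2) / (4 * d)"
  have disc: "b\<^sup>2 < 4 * A * G" using discriminant_pos[OF d A(1) True] by (simp add: G_def b_def)
  have \<delta>0: "0 < \<delta>" using disc d by (simp add: \<delta>_def)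
  have G0: "0 < G" using A by (simp add: G_def)
  have "\<delta> \<le> 4 * A * G / (4 * d)" unfolding \<delta>_def using d by (intro divide_right_mono) auto
  also have "\<dots> < G" using G0 A d by (simp add: divide_simps)
  finally have \<delta>G: "\<delta> < G" .
  have eq: "4 * (A - \<delta>) * (G - \<delta>) - b\<^sup>2 = 4 * \<delta>\<^sup>2"
  proof -
    have "4 * d * \<delta> = 4 * A * G - b\<^sup>2" using d by (simp add: \<delta>_def)
    then show ?thesis unfolding G_def by (simp add: algebra_simps power2_eq_square)
  qed
  \<comment> \<open>The margin \<open>\<delta>\<close> in the coefficient of
    \<open>P\<^sup>2\<close> is split in three: one third is \<open>m\<close>, two thirds are
    \<open>2 * \<epsilon>\<close>.\<close>
  have "\<delta> / 3 * (P\<^sup>2 + W\<^sup>2) \<le> (A - 2 * (\<delta> / 3)) * P\<^sup>2 + b * P * W + G * W\<^sup>2" for P W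
  proof -
    have "4 * (G - \<delta>) * ((A - \<delta>) * P\<^sup>2 + b * P * W + (G - \<delta>) * W\<^sup>2)
        = (2 * (G - \<delta>) * W + b * P)\<^sup>2 + (4 * (A - \<delta>) * (G - \<delta>) - b\<^sup>2) * P\<^sup>2"
      by (simp add: algebra_simps power2_eq_square)
    also have "\<dots> \<ge> 0" unfolding eq by simp
    finally have "0 \<le> (A - \<delta>) * P\<^sup>2 + b * P * W + (G - \<delta>) * W\<^sup>2"
      using \<delta>G by (simp add: zero_le_mult_iff)
    moreover have "0 \<le> 2 * \<delta> / 3 * W\<^sup>2" using \<delta>0 by simp
    ultimately show ?thesis by (simp add: algebra_simps)
  qed
  then show ?thesis
    using \<delta>0 by (intro exI[of _ "\<delta> / 3"] conjI) (auto simp: G_def b_def)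
next
  case False
  define G where "G = d - A"
  define m where "m = min (1 / 4) (G / 2)"
  have m: "0 < m" "m \<le> 1 / 4" "m \<le> G / 2"
    unfolding m_def by (rule min.cobounded1 min.cobounded2 | use A in \<open>simp add: G_def\<close>)+
  have "m * (P\<^sup>2 + W\<^sup>2) \<le> (A - 2 * (1 / 4)) * P\<^sup>2 + (d - 2) * P * W + G * W\<^sup>2" if "P > 0" "- P \<le> W" for P W
  proof -
    \<comment> \<open>\<open>\<tau>\<close> measures the distance from the edge
      \<open>W = - P\<close> of the sector. In \<open>P\<close> and \<open>\<tau>\<close> all
      coefficients of the form are nonnegative, and that of \<open>P\<^sup>2\<close> is 2 whatever
      \<open>d\<close> and \<open>A\<close> are.\<close>
    define \<tau> where "\<tau> = W + P"
    have \<tau>: "0 \<le> \<tau>" using that by (simp add: \<tau>_def)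
    have "A * P\<^sup>2 + (d - 2) * P * W + G * W\<^sup>2 = 2 * P\<^sup>2 + (2 * A - d - 2) * (P * \<tau>) + G * \<tau>\<^sup>2"
      by (simp add: \<tau>_def G_def algebra_simps power2_eq_square)
    moreover have "0 \<le> (2 * A - d - 2) * (P * \<tau>)" using False \<tau> that by (intro mult_nonneg_nonneg) auto
    moreover have "m * (P\<^sup>2 + W\<^sup>2) \<le> m * (3 * P\<^sup>2) + m * (2 * \<tau>\<^sup>2)"
    proof -
      have "W\<^sup>2 \<le> 2 * P\<^sup>2 + 2 * \<tau>\<^sup>2"
        using zero_le_power2[of "\<tau> + P"] by (simp add: \<tau>_def algebra_simps power2_eq_square)
      then have "P\<^sup>2 + W\<^sup>2 \<le> 3 * P\<^sup>2 + 2 * \<tau>\<^sup>2" by simp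
      from mult_left_mono[OF this, of m] show ?thesis using m(1) by (simp add: distrib_left)
    qed
    moreover have "m * (3 * P\<^sup>2) \<le> 1 / 4 * (3 * P\<^sup>2)" using m by (intro mult_right_mono) auto
    moreover have "m * (2 * \<tau>\<^sup>2) \<le> G / 2 * (2 * \<tau>\<^sup>2)" using m by (intro mult_right_mono) auto
    moreover have "0 \<le> P\<^sup>2" by simp
    ultimately show ?thesis unfolding left_diff_distrib by linarith
  qed
  then show ?thesis
    using m(1) by (intro exI[of _ m] conjI exI[of _ "1/4"]) (auto simp: G_def)
qed

text \<open>A barrier argument from a point where \<open>f\<close> itself may be undefined. Extended
  by 0, \<open>f\<close> attains a minimum on \<open>{0..y}\<close>. A positive minimum point with
  \<open>f \<le> 0\<close> contradicts \<open>f' > 0\<close>; if the minimum is at 0, then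
  \<open>f y \<le> 0\<close> makes \<open>y\<close> another minimum point.\<close>

lemma positive_if_increasing_when_nonpositive:
  fixes f f' :: "real \<Rightarrow> real"
  assumes lim: "(f \<longlongrightarrow> 0) (at_right 0)"
    and deriv: "\<And>y. 0 < y \<Longrightarrow> y < R \<Longrightarrow> (f has_real_derivative f' y) (at y)"
    and incr: "\<And>y. 0 < y \<Longrightarrow> y < R \<Longrightarrow> f y \<le> 0 \<Longrightarrow> 0 < f' y"
    and y: "0 < y" "y < R"
  shows "0 < f y"
proof (rule ccontr)
  assume "\<not> 0 < f y"
  define h where "h x = (if x = 0 then 0 else f x)" for x
  have "continuous_on {0..y} h"
    unfolding continuous_on_def
  proof
    fix x assume x: "x \<in> {0..y}"
    show "(h \<longlongrightarrow> h x) (at x within {0..y})"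
    proof (cases "x = 0")
      case True
      have "(h \<longlongrightarrow> 0) (at_right 0)"
        by (rule Lim_transform_eventually[OF lim]) (auto simp: h_def eventually_at_filter)
      then show ?thesis using True y by (simp add: h_def at_within_Icc_at_right)
    next
      case False
      then have "isCont f x" using deriv[of x] x y DERIV_isCont by auto
      then have "(f \<longlongrightarrow> h x) (at x within {0..y})"
        using False by (simp add: h_def isCont_def Lim_at_imp_Lim_at_within)
      moreover have "\<forall>\<^sub>F z in at x within {0..y}. z \<noteq> 0"
        by (rule eventually_neq_at_within)
      then have "\<forall>\<^sub>F z in at x within {0..y}. f z = h z" by eventually_elim (simp add: h_def)
      ultimately show ?thesis by (rule Lim_transform_eventually)
    qed
  qed
  then obtain x where x: "x \<in> {0..y}" and xm: "\<And>z. z \<in> {0..y} \<Longrightarrow> h x \<le> h z"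
    using continuous_attains_inf[of "{0..y}" h] y by auto
  have not_min: False if z: "0 < z" "z \<le> y" and zm: "\<And>w. w \<in> {0..y} \<Longrightarrow> h z \<le> h w" for z
  proof -
    have "h z \<le> h y" using zm y by simp
    then have "f z \<le> 0" using z y \<open>\<not> 0 < f y\<close> by (simp add: h_def)
    then have "0 < f' z" using incr z y by auto
    from DERIV_pos_inc_left[OF deriv this] obtain e where e: "e > 0" "\<And>h. h > 0 \<Longrightarrow> h < e \<Longrightarrow> f (z - h) < f z"
      using z y by auto
    define t where "t = min (e / 2) (z / 2)"
    have "f (z - t) < f z" using e z by (auto simp: t_def)
    moreover have "h z \<le> h (z - t)" using z e by (intro zm) (auto simp: t_def)
    ultimately show False using z by (auto simp: h_def t_def split: if_splits)
  qed
  show False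
  proof (cases "x = 0")
    case True
    then have "0 \<le> h z" if "z \<in> {0..y}" for z using xm[OF that] by (simp add: h_def)
    moreover have "h y \<le> 0" using \<open>\<not> 0 < f y\<close> by (simp add: h_def)
    ultimately show False using y by (intro not_min[of y]) (auto intro: order_trans)
  next
    case False
    then show False using x xm by (intro not_min[of x]) auto
  qed
qed

text \<open>\<open>P\<close> and \<open>W\<close> are the coordinates relative to the fixed point. The derivative of the angle
  \<open>arctan (W / P)\<close> is the form above plus a cubic term, which is harmless once \<open>W \<ge> - \<epsilon>\<close>; combined
  with \<open>- P\<close>, which takes over where \<open>W\<close> is large, it yields a bounded function
  that grows at least as fast as \<open>G * s\<close>.\<close>

lemma phase_plane_time_bound:
  fixes d A c \<gamma> m \<epsilon> R :: real and P W s :: "real \<Rightarrow> real"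
  defines "G \<equiv> d - A"
  assumes A: "0 < A" and G: "0 < G" and \<gamma>: "0 \<le> \<gamma>" "\<gamma> \<le> 2" "(2 - \<gamma>) * A = 2" and c: "0 < c"
    and m: "0 < m" and \<epsilon>: "0 < \<epsilon>"
    and form: "\<And>P W. 0 < P \<Longrightarrow> - P \<le> W \<Longrightarrow>
        m * (P\<^sup>2 + W\<^sup>2) \<le> (A - 2 * \<epsilon>) * P\<^sup>2 + (d - 2) * P * W + G * W\<^sup>2"
    and dP: "\<And>y. 0 < y \<Longrightarrow> y < R \<Longrightarrow> (P has_real_derivative - (G + P y) * (P y + W y) / y) (at y)"
    and dW: "\<And>y. 0 < y \<Longrightarrow> y < R \<Longrightarrow> (W has_real_derivative (A + W y) * (P y + (\<gamma> - 1) * W y) / y) (at y)"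
    and ds: "\<And>y. 0 < y \<Longrightarrow> y < R \<Longrightarrow> (s has_real_derivative (A + W y) / y) (at y)"
    and s: "continuous_on {0..R} s" "s 0 = 0"
    and P: "\<And>y. 0 < y \<Longrightarrow> y < R \<Longrightarrow> 0 < P y" "\<And>y. 0 < y \<Longrightarrow> y < R \<Longrightarrow> P y \<le> A"
    and PW: "\<And>y. 0 < y \<Longrightarrow> y < R \<Longrightarrow> 0 < P y + W y"
    and W: "\<And>y. 0 < y \<Longrightarrow> y < R \<Longrightarrow> - A * exp (- c * s y) \<le> W y"
    and y: "0 < y" "y < R"
  shows "s y \<le> max 1 (ln (A / \<epsilon>) / c) + (A + 4 * (G * A / m)) / G"
proof -
  \<comment> \<open>From \<open>s = s1\<close> on,
    \<open>A * exp (- c * s) \<le> \<epsilon>\<close>, hence \<open>W \<ge> - \<epsilon>\<close>.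
    The \<open>1\<close> keeps \<open>s1\<close> positive, so that it is attained away from the
    centre, where \<open>s\<close> vanishes.\<close>
  define s1 where "s1 = max 1 (ln (A / \<epsilon>) / c)"
  \<comment> \<open>\<open>B * m = G * A\<close>: in the derivative of \<open>\<Phi>\<close> the
    angle pays for the part \<open>G * A\<close> of the growth rate \<open>G * (A + W)\<close> of
    \<open>G * s\<close>, and \<open>- P\<close> pays for \<open>G * W\<close>.\<close>
  define B where "B = G * A / m"
  have B0: "0 < B" using A G m by (simp add: B_def)
  define \<Phi> where "\<Phi> y = - P y + B * arctan (W y / P y) - G * s y" for y
  have "s y \<le> s1 + (A + 4 * B) / G"
  proof (cases "s y \<le> s1")
    case True
    moreover have "0 \<le> (A + 4 * B) / G" using A B0 G by simp
    ultimately show ?thesis by linarith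
  next
    case False
    have "continuous_on {0..y} s" using y by (intro continuous_on_subset[OF s(1)]) auto
    then obtain x where x: "0 \<le> x" "x \<le> y" "s x = s1"
      using IVT'[of s 0 s1 y] False s(2) y by (fastforce simp: s1_def)
    have x0: "0 < x" using x s(2) by (cases "x = 0") (auto simp: s1_def)
    have smono: "s z1 \<le> s z2" if "x \<le> z1" "z1 \<le> z2" "z2 \<le> y" for z1 z2
    proof (rule DERIV_nonneg_imp_increasing_open[OF that(2)])
      fix z assume z: "z1 < z" "z < z2"
      have "0 < A + W z"
      proof -
        have "0 < P z + W z" "P z \<le> A" using PW[of z] P(2)[of z] z that x0 y by auto
        then show ?thesis by linarith
      qed
      then show "\<exists>D. (s has_real_derivative D) (at z) \<and> 0 \<le> D"
        using ds[of z] z that x0 y by (intro exI[of _ "(A + W z) / z"]) auto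
    next
      show "continuous_on {z1..z2} s" using that x0 y by (intro continuous_on_subset[OF s(1)]) auto
    qed
    have "\<Phi> x \<le> \<Phi> y"
    proof (rule DERIV_nonneg_imp_increasing_open[OF x(2)])
      fix z assume z: "x < z" "z < y"
      then have zR: "0 < z" "z < R" using x0 y by auto
      note facts = P[OF zR] PW[OF zR]
      let ?P = "P z" and ?W = "W z"
      define S where "S = ?P\<^sup>2 + ?W\<^sup>2"
      define N where "N = (A + ?W) * (?P + (\<gamma> - 1) * ?W) * ?P + (G + ?P) * (?P + ?W) * ?W"
      have S0: "0 < S" using facts by (simp add: S_def add_pos_nonneg)
      have "- \<epsilon> \<le> ?W"
      proof -
        have "ln (A / \<epsilon>) / c \<le> s z" using smono[of x z] x z by (auto simp: s1_def)
        then have "ln (A / \<epsilon>) \<le> c * s z" using c by (simp add: field_simps)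
        then have "exp (- (c * s z)) \<le> exp (- ln (A / \<epsilon>))" by simp
        then have "exp (- c * s z) \<le> \<epsilon> / A" using A \<epsilon> by (simp add: exp_minus)
        then have "A * exp (- c * s z) \<le> \<epsilon>" using A by (simp add: field_simps)
        then show ?thesis using W[OF zR] by linarith
      qed
      \<comment> \<open>The cubic term of the angular derivative. For \<open>W < 0\<close> the
        sector gives \<open>- W < P\<close>, so with \<open>\<gamma> \<le> 2\<close> the last factor
        lies between 0 and \<open>2 * P\<close>, and \<open>- W \<le> \<epsilon>\<close> bounds the
        loss.\<close>
      have extra: "- 2 * \<epsilon> * ?P\<^sup>2 \<le> ?P * ?W * (2 * ?P + \<gamma> * ?W)"
      proof (cases "0 \<le> ?W")
        case True
        then have "0 \<le> ?P * ?W * (2 * ?P + \<gamma> * ?W)" using facts \<gamma> by simp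
        moreover have "0 \<le> 2 * \<epsilon> * ?P\<^sup>2" using \<epsilon> by simp
        ultimately show ?thesis by linarith
      next
        case False
        have "\<gamma> * (- ?W) \<le> 2 * (- ?W)" using False \<gamma> by (intro mult_right_mono) auto
        then have q: "0 \<le> 2 * ?P + \<gamma> * ?W" using facts by simp
        have "(- ?W) * (?P * (2 * ?P + \<gamma> * ?W)) \<le> \<epsilon> * (?P * (2 * ?P))"
          using \<open>- \<epsilon> \<le> ?W\<close> q facts False \<gamma> \<epsilon>
          by (intro mult_mono) (auto simp: mult_nonneg_nonpos)
        then show ?thesis by (simp add: power2_eq_square algebra_simps)
      qed
      \<comment> \<open>\<open>N / S\<close> is the derivative of the angle with respect to
        \<open>ln z\<close>. The relation \<open>(2 - \<gamma>) * A = 2\<close> turns the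
        coefficient \<open>A * (\<gamma> - 1) + G\<close> of \<open>P * W\<close> into
        \<open>d - 2\<close>.\<close>
      have "N = A * ?P\<^sup>2 + (d - 2) * ?P * ?W + G * ?W\<^sup>2 + ?P * ?W * (2 * ?P + \<gamma> * ?W)"
      proof -
        have "A * \<gamma> = 2 * A - 2" using \<gamma>(3) by (simp add: algebra_simps)
        then show ?thesis unfolding N_def G_def by algebra
      qed
      then have mS: "m * S \<le> N"
        using form[of ?P ?W] facts extra unfolding S_def by (simp add: algebra_simps)
      have "(\<Phi> has_real_derivative ((G + ?P) * (?P + ?W) + B * (N / S) - G * (A + ?W)) / z) (at z)"
      proof -
        have e: "((A + ?W) * (?P + (\<gamma> - 1) * ?W) / z * ?P - ?W * (- (G + ?P) * (?P + ?W) / z)) / (?P * ?P)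
            * inverse (1 + (?W / ?P)\<^sup>2) = N / S / z"
        proof -
          have "?P * ?P * (1 + (?W / ?P)\<^sup>2) = S" using facts by (simp add: S_def field_simps power2_eq_square)
          moreover have "(A + ?W) * (?P + (\<gamma> - 1) * ?W) / z * ?P - ?W * (- (G + ?P) * (?P + ?W) / z) = N / z"
            using zR by (simp add: N_def field_simps)
          ultimately show ?thesis by (simp add: field_simps)
        qed
        have "((\<lambda>y. arctan (W y / P y)) has_real_derivative N / S / z) (at z)"
          unfolding e[symmetric]
          using DERIV_chain2[OF DERIV_arctan DERIV_divide[OF dW[OF zR] dP[OF zR]]] facts
          by (simp add: mult.commute)
        then have "(\<Phi> has_real_derivative
            - (- (G + ?P) * (?P + ?W) / z) + B * (N / S / z) - G * ((A + ?W) / z)) (at z)"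
          unfolding \<Phi>_def
          by (intro DERIV_diff DERIV_add DERIV_minus DERIV_cmult dP[OF zR] ds[OF zR])
        moreover have "- (- a * b / z) + B * (n / z) - G * (k / z) = (a * b + B * n - G * k) / z" for a b n k
          by (simp add: add_divide_distrib diff_divide_distrib)
        ultimately show ?thesis by (simp only:)
      qed
      moreover have "0 \<le> ((G + ?P) * (?P + ?W) + B * (N / S) - G * (A + ?W)) / z"
      proof -
        have "m \<le> N / S" using mS S0 by (simp add: pos_le_divide_eq)
        then have "B * m \<le> B * (N / S)" using B0 by (intro mult_left_mono) auto
        moreover have "B * m = G * A" using m by (simp add: B_def)
        moreover have "G * ?W \<le> G * (?P + ?W)" using facts G by (intro mult_left_mono) auto
        moreover have "G * (?P + ?W) \<le> (G + ?P) * (?P + ?W)" using facts by (intro mult_right_mono) auto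
        ultimately have "0 \<le> (G + ?P) * (?P + ?W) + B * (N / S) - G * (A + ?W)"
          by (simp add: distrib_left)
        then show ?thesis using zR by simp
      qed
      ultimately show "\<exists>D. (\<Phi> has_real_derivative D) (at z) \<and> 0 \<le> D" by blast
    next
      have "isCont P z" "isCont W z" "P z \<noteq> 0" if "z \<in> {x..y}" for z
        using that dP[of z] dW[of z] P(1)[of z] x0 y by (auto dest: DERIV_isCont)
      then have "continuous_on {x..y} P" "continuous_on {x..y} W" "\<forall>z\<in>{x..y}. P z \<noteq> 0"
        by (auto intro: continuous_at_imp_continuous_on)
      moreover have "continuous_on {x..y} s" using x0 y by (intro continuous_on_subset[OF s(1)]) auto
      ultimately show "continuous_on {x..y} \<Phi>" unfolding \<Phi>_def by (intro continuous_intros)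
    qed
    moreover have "\<Phi> y \<le> B * 2 - G * s y"
    proof -
      have "arctan (W y / P y) \<le> 2" using arctan_ubound[of "W y / P y"] pi_less_4 by linarith
      then have "B * arctan (W y / P y) \<le> B * 2" using B0 by (intro mult_left_mono) auto
      then show ?thesis using P(1)[OF y] by (simp add: \<Phi>_def)
    qed
    moreover have "- A - B * 2 - G * s1 \<le> \<Phi> x"
    proof -
      have "- 2 \<le> arctan (W x / P x)" using arctan_lbound[of "W x / P x"] pi_less_4 by linarith
      then have "B * (- 2) \<le> B * arctan (W x / P x)" using B0 by (intro mult_left_mono) auto
      then show ?thesis using P(2)[of x] x x0 y by (simp add: \<Phi>_def)
    qed
    ultimately have "G * (s y - s1) \<le> A + 4 * B" by (simp add: algebra_simps)
    then show ?thesis using G by (simp add: field_simps)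
  qed
  then show ?thesis by (simp add: s1_def B_def)
qed

section \<open>Liquid Lane--Emden stars\<close>

text \<open>Derivatives are kept in the shape \<open>a * f r / r\<close>: then \<open>a\<close> is
  the derivative of \<open>ln f\<close> with respect to \<open>ln r\<close>, and products and
  quotients just add and subtract these rates.\<close>

lemma log_deriv_mult:
  fixes f h :: "real \<Rightarrow> real"
  assumes "(f has_real_derivative a * f r / r) F" "(h has_real_derivative b * h r / r) F" "F = at r within S"
  shows "((\<lambda>x. f x * h x) has_real_derivative (a + b) * (f r * h r) / r) F"
  using DERIV_mult[OF assms(1,2)[unfolded assms(3)]] unfolding assms(3) by (simp add: algebra_simps add_divide_distrib)

lemma log_deriv_divide:
  fixes f h :: "real \<Rightarrow> real"
  assumes "(f has_real_derivative a * f r / r) F" "(h has_real_derivative b * h r / r) F" "F = at r within S" "h r \<noteq> 0"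
  shows "((\<lambda>x. f x / h x) has_real_derivative (a - b) * (f r / h r) / r) F"
proof -
  have "(a * f r / r * h r - f r * (b * h r / r)) / (h r * h r) = (a - b) * (f r / h r) / r"
    using assms(4) by (cases "r = 0") (simp_all add: field_simps)
  then show ?thesis
    using DERIV_divide[OF assms(1,2)[unfolded assms(3)] assms(4)] unfolding assms(3) by simp
qed

lemma log_deriv_power:
  "(r::real) \<noteq> 0 \<Longrightarrow> ((\<lambda>x. x ^ n) has_real_derivative real n * r ^ n / r) (at r within S)"
  using DERIV_subset[OF DERIV_pow[of n r] subset_UNIV] by (cases n) auto

text \<open>The derivative at \<open>R\<close> is two-sided because the gaseous profile continues
  beyond the surface. The normalisation \<open>\<rho> R = 1\<close> enters in the final theorem, and
  \<open>d < 10\<close> through the form handed to \<open>crossing\<close>.\<close>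

locale liquid_star =
  fixes d :: nat and \<gamma> R :: real and \<rho> :: "real \<Rightarrow> real"
  assumes d3: "3 \<le> d" and g1: "1 \<le> \<gamma>" and gd: "\<gamma> < 2 * (real d - 1) / real d"
    and R: "0 < R" and \<rho>_cont: "continuous_on {0..R} \<rho>"
    and \<rho>_pos: "r \<in> {0..R} \<Longrightarrow> 0 < \<rho> r"
    and lane_emden: "r \<in> {0<..R} \<Longrightarrow>
      ((\<lambda>s. \<rho> s powr \<gamma>) has_real_derivative (- \<rho> r * LE_mass d \<rho> r / r ^ (d - 1))) (at r)"
begin

abbreviation "M \<equiv> LE_mass d \<rho>"
abbreviation "I \<equiv> {0..R}"

text \<open>With \<open>t = ln r\<close> these are \<open>g = d (ln M) / dt\<close> and \<open>u = - d (ln \<rho>) / dt\<close>; they satisfy an autonomous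
  planar system, whose trajectory emanates from \<open>(d, 0)\<close> at the centre of the star.\<close>

definition g where "g r = 4 * pi * r ^ d * \<rho> r / M r"
definition u where "u r = M r * r\<^sup>2 / (\<gamma> * \<rho> r powr (\<gamma> - 1) * r ^ d)"

lemma g2: "\<gamma> < 2"
proof -
  have "2 * (real d - 1) / real d < 2" using d3 by (simp add: field_simps)
  then show ?thesis using gd by linarith
qed

section \<open>Mass and density of a star\<close>

lemma power_pred: "r \<noteq> 0 \<Longrightarrow> r ^ (d - 1) = r ^ d / (r :: real)"
  using d3 by (cases d) auto

lemma mass_deriv:
  assumes "r \<in> I"
  shows "(M has_real_derivative 4 * pi * (r ^ (d - 1) * \<rho> r)) (at r within I)"
  unfolding LE_mass_def[abs_def]
  by (intro DERIV_cmult integral_has_real_derivative assms continuous_intros \<rho>_cont)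

lemma mass_cont: "continuous_on I M"
  by (rule DERIV_continuous_on[OF mass_deriv])

lemma mass_0: "M 0 = 0" by (simp add: LE_mass_def)

lemma at_interior: "0 < r \<Longrightarrow> r < R \<Longrightarrow> at r within I = at r"
  by (rule at_within_Icc_at)

lemma mass_bounds:
  assumes r: "r \<in> I" and a: "\<And>x. x \<in> {0..r} \<Longrightarrow> a \<le> \<rho> x" and b: "\<And>x. x \<in> {0..r} \<Longrightarrow> \<rho> x \<le> b"
  shows "4 * pi * a * r ^ d / d \<le> M r" "M r \<le> 4 * pi * b * r ^ d / d"
proof -
  have i: "((\<lambda>x. c * x ^ (d - 1)) has_integral c * r ^ d / d - c * 0 ^ d / d) {0..r}" for c
    using r d3 by (intro fundamental_theorem_of_calculus)
      (auto simp: has_real_derivative_iff_has_vector_derivative[symmetric] intro!: derivative_eq_intros)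
  have i': "integral {0..r} (\<lambda>x. c * x ^ (d - 1)) = c * r ^ d / d" for c
    using integral_unique[OF i[of c]] d3 by simp
  have j: "(\<lambda>x. x ^ (d - 1) * \<rho> x) integrable_on {0..r}"
    using r by (intro integrable_continuous_real continuous_intros continuous_on_subset[OF \<rho>_cont]) auto
  have "a * r ^ d / d \<le> integral {0..r} (\<lambda>x. x ^ (d - 1) * \<rho> x)"
    unfolding i'[symmetric]
    by (rule integral_le[OF has_integral_integrable[OF i] j]) (use a in \<open>auto simp: mult.commute[of a] intro!: mult_left_mono\<close>)
  then have "4 * pi * (a * r ^ d / d) \<le> M r" unfolding LE_mass_def by (intro mult_left_mono) auto
  then show "4 * pi * a * r ^ d / d \<le> M r" by (simp add: mult.assoc)
  have "integral {0..r} (\<lambda>x. x ^ (d - 1) * \<rho> x) \<le> b * r ^ d / d"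
    unfolding i'[symmetric]
    by (rule integral_le[OF j has_integral_integrable[OF i]]) (use b in \<open>auto simp: mult.commute[of b] intro!: mult_left_mono\<close>)
  then have "M r \<le> 4 * pi * (b * r ^ d / d)" unfolding LE_mass_def by (intro mult_left_mono) auto
  then show "M r \<le> 4 * pi * b * r ^ d / d" by (simp add: mult.assoc)
qed

lemma mass_pos: "0 < r \<Longrightarrow> r \<le> R \<Longrightarrow> 0 < M r"
proof -
  assume r: "0 < r" "r \<le> R"
  have "{0..r} \<noteq> {}" using r by auto
  then obtain x where x: "x \<in> {0..r}" "\<And>z. z \<in> {0..r} \<Longrightarrow> \<rho> x \<le> \<rho> z"
    using continuous_attains_inf[of "{0..r}" \<rho>] continuous_on_subset[OF \<rho>_cont, of "{0..r}"] r by auto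
  obtain y where y: "\<And>z. z \<in> {0..r} \<Longrightarrow> \<rho> z \<le> \<rho> y"
    using continuous_attains_sup[of "{0..r}" \<rho>] continuous_on_subset[OF \<rho>_cont, of "{0..r}"] r by force
  have "0 < 4 * pi * \<rho> x * r ^ d / d" using \<rho>_pos[of x] x r d3 by simp
  also have "\<dots> \<le> M r" using mass_bounds(1)[of r "\<rho> x" "\<rho> y"] x y r by auto
  finally show "0 < M r" .
qed

lemma ln_density_deriv:
  assumes r: "0 < r" "r \<le> R"
  shows "((\<lambda>s. ln (\<rho> s)) has_real_derivative - u r / r) (at r within I)"
proof -
  have \<rho>: "0 < \<rho> r" using \<rho>_pos r by simp
  have "((\<lambda>s. \<rho> s powr \<gamma>) has_real_derivative (- \<rho> r * M r / r ^ (d - 1))) (at r within I)"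
    by (rule has_field_derivative_at_within[OF lane_emden]) (use r in auto)
  then have "((\<lambda>s. ln (\<rho> s powr \<gamma>)) has_real_derivative
      1 / (\<rho> r powr \<gamma>) * (- \<rho> r * M r / r ^ (d - 1))) (at r within I)"
    by (rule DERIV_chain2[OF DERIV_ln_divide, rotated]) (use \<rho> in auto)
  then have "((\<lambda>s. ln (\<rho> s powr \<gamma>) / \<gamma>) has_real_derivative
      (1 / (\<rho> r powr \<gamma>) * (- \<rho> r * M r / r ^ (d - 1))) / \<gamma>) (at r within I)"
    by (rule DERIV_cdivide)
  also have "(1 / (\<rho> r powr \<gamma>) * (- \<rho> r * M r / r ^ (d - 1))) / \<gamma> = - u r / r"
    using r \<rho> g1 unfolding u_def power_pred[OF less_imp_neq[OF r(1), THEN not_sym]]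
    by (simp add: powr_diff field_simps power2_eq_square)
  finally show ?thesis
    by (rule has_field_derivative_transform_within[OF _ zero_less_one])
       (use r \<rho>_pos g1 in \<open>auto simp: ln_powr less_imp_neq[THEN not_sym]\<close>)
qed

lemma density_powr_deriv:
  assumes r: "0 < r" "r \<le> R"
  shows "((\<lambda>s. \<rho> s powr a) has_real_derivative - a * u r * \<rho> r powr a / r) (at r within I)"
proof -
  have \<rho>: "\<rho> r \<noteq> 0" using \<rho>_pos[of r] r by simp
  have "((\<lambda>s. exp (a * ln (\<rho> s))) has_real_derivative exp (a * ln (\<rho> r)) * (a * (- u r / r))) (at r within I)"
    by (intro DERIV_chain2[OF DERIV_exp] DERIV_cmult ln_density_deriv r)
  then have "((\<lambda>s. exp (a * ln (\<rho> s))) has_real_derivative - a * u r * \<rho> r powr a / r) (at r within I)"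
    using \<rho> by (simp add: powr_def mult_ac)
  then show ?thesis
    by (rule has_field_derivative_transform_within[OF _ zero_less_one])
       (use r \<rho>_pos in \<open>auto simp: powr_def less_imp_neq[THEN not_sym]\<close>)
qed

lemma u_pos: "0 < r \<Longrightarrow> r \<le> R \<Longrightarrow> 0 < u r"
  unfolding u_def using mass_pos[of r] \<rho>_pos[of r] g1 by simp

lemma g_pos: "0 < r \<Longrightarrow> r \<le> R \<Longrightarrow> 0 < g r"
  unfolding g_def using mass_pos[of r] \<rho>_pos[of r] by simp

lemma density_antimono:
  assumes "0 \<le> x" "x \<le> y" "y \<le> R"
  shows "\<rho> y \<le> \<rho> x"
proof -
  have "ln (\<rho> y) \<le> ln (\<rho> x)"
  proof (rule DERIV_nonpos_imp_decreasing_open[OF assms(2)])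
    fix z assume z: "x < z" "z < y"
    then show "\<exists>D. ((\<lambda>x. ln (\<rho> x)) has_real_derivative D) (at z) \<and> D \<le> 0"
      using ln_density_deriv[of z] u_pos[of z] assms at_interior[of z]
      by (intro exI[of _ "- u z / z"]) auto
  next
    show "continuous_on {x..y} (\<lambda>x. ln (\<rho> x))"
      using assms \<rho>_pos by (intro continuous_on_ln continuous_on_subset[OF \<rho>_cont]) (auto simp: less_imp_neq[THEN not_sym])
  qed
  then show ?thesis using \<rho>_pos[of x] \<rho>_pos[of y] assms by simp
qed

lemma mass_le: "r \<in> I \<Longrightarrow> M r \<le> 4 * pi * \<rho> 0 * r ^ d / d"
  by (rule mass_bounds(2)[of r "\<rho> r"]) (auto intro: density_antimono)

lemma mass_ge: "r \<in> I \<Longrightarrow> 4 * pi * \<rho> r * r ^ d / d \<le> M r"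
  by (rule mass_bounds(1)[of r _ "\<rho> 0"]) (auto intro: density_antimono)

lemma g_le: "0 < r \<Longrightarrow> r \<le> R \<Longrightarrow> g r \<le> d"
  using mass_ge[of r] mass_pos[of r] d3 by (simp add: g_def field_simps)

lemma g_ge: "0 < r \<Longrightarrow> r \<le> R \<Longrightarrow> d * \<rho> r / \<rho> 0 \<le> g r"
  using mass_le[of r] mass_pos[of r] \<rho>_pos[of 0] \<rho>_pos[of r] R d3
  by (simp add: g_def divide_simps) (simp add: mult_ac)

section \<open>The autonomous system and its fixed point\<close>

lemma mass_log_deriv:
  assumes r: "0 < r" "r \<le> R"
  shows "(M has_real_derivative g r * M r / r) (at r within I)"
  using mass_deriv[of r] mass_pos[OF r] r by (simp add: g_def power_pred mult.assoc del: One_nat_def)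

lemma density_log_deriv:
  assumes r: "0 < r" "r \<le> R"
  shows "(\<rho> has_real_derivative - u r * \<rho> r / r) (at r within I)"
proof -
  have "\<rho> s powr 1 = \<rho> s" if "s \<in> I" for s
    using \<rho>_pos[OF that] by simp
  moreover have "((\<lambda>s. \<rho> s powr 1) has_real_derivative - 1 * u r * \<rho> r powr 1 / r) (at r within I)"
    by (rule density_powr_deriv[OF r])
  ultimately show ?thesis
    using has_field_derivative_transform_within[of "\<lambda>s. \<rho> s powr 1" "- u r * \<rho> r / r" r I 1 \<rho>] r by simp
qed

lemma g_deriv:
  assumes r: "0 < r" "r \<le> R"
  shows "(g has_real_derivative (d - u r - g r) * g r / r) (at r within I)"
proof -
  have c: "((\<lambda>x. 4 * pi) has_real_derivative 0 * (4 * pi) / r) (at r within I)" by simp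
  have "((\<lambda>x. 4 * pi * x ^ d * \<rho> x / M x) has_real_derivative
      (0 + real d + (- u r) - g r) * (4 * pi * r ^ d * \<rho> r / M r) / r) (at r within I)"
    by (intro log_deriv_divide[OF log_deriv_mult[OF log_deriv_mult[OF c log_deriv_power refl] _ refl] _ refl]
        density_log_deriv mass_log_deriv r) (use r mass_pos[OF r] in auto)
  then show ?thesis by (simp add: g_def[abs_def])
qed

lemma u_deriv:
  assumes r: "0 < r" "r \<le> R"
  shows "(u has_real_derivative (g r + (\<gamma> - 1) * u r - (real d - 2)) * u r / r) (at r within I)"
proof -
  have c: "((\<lambda>x. \<gamma>) has_real_derivative 0 * \<gamma> / r) (at r within I)" by simp
  have e: "((\<lambda>x. \<rho> x powr (\<gamma> - 1)) has_real_derivative - (\<gamma> - 1) * u r * \<rho> r powr (\<gamma> - 1) / r) (at r within I)"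
    by (rule density_powr_deriv[OF r])
  have main: "((\<lambda>x. M x * x\<^sup>2 / (\<gamma> * \<rho> x powr (\<gamma> - 1) * x ^ d)) has_real_derivative
      (g r + real 2 - (0 + (- (\<gamma> - 1) * u r) + d)) * (M r * r\<^sup>2 / (\<gamma> * \<rho> r powr (\<gamma> - 1) * r ^ d)) / r) (at r within I)"
    by (intro log_deriv_divide[OF log_deriv_mult[OF _ log_deriv_power refl]
           log_deriv_mult[OF log_deriv_mult[OF c e refl] log_deriv_power refl] refl] mass_log_deriv r)
       (use r \<rho>_pos[of r] g1 in auto)
  have "g r + real 2 - (0 + (- (\<gamma> - 1) * u r) + d) = g r + (\<gamma> - 1) * u r - (real d - 2)"
    by (simp add: algebra_simps)
  with main[folded u_def] show ?thesis by (simp only:)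
qed

text \<open>The fixed point of the system for \<open>(g, u)\<close>, i.e. the singular power-law solution.\<close>

definition u\<^sub>c where "u\<^sub>c = 2 / (2 - \<gamma>)"
definition g\<^sub>c where "g\<^sub>c = real d - u\<^sub>c"

lemma fixed_point: "(2 - \<gamma>) * u\<^sub>c = 2" "2 \<le> u\<^sub>c" "u\<^sub>c < d" "0 < g\<^sub>c"
proof -
  show "(2 - \<gamma>) * u\<^sub>c = 2"
    using g2 by (simp only: u\<^sub>c_def times_divide_eq_right nonzero_mult_div_cancel_left)
  show "2 \<le> u\<^sub>c" using g1 g2 by (simp add: u\<^sub>c_def field_simps)
  have "\<gamma> * d < 2 * (real d - 1)" using gd d3 by (simp add: field_simps)
  then show "u\<^sub>c < d" using g2 by (simp add: u\<^sub>c_def field_simps)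
  then show "0 < g\<^sub>c" by (simp add: g\<^sub>c_def)
qed

lemma derivs_at:
  assumes "0 < r" "r < R"
  shows "(g has_real_derivative (d - u r - g r) * g r / r) (at r)"
    and "(u has_real_derivative (g r + (\<gamma> - 1) * u r - (real d - 2)) * u r / r) (at r)"
    and "(M has_real_derivative g r * M r / r) (at r)"
    and "((\<lambda>s. \<rho> s powr a) has_real_derivative - a * u r * \<rho> r powr a / r) (at r)"
    and "(\<rho> has_real_derivative - u r * \<rho> r / r) (at r)"
    and "((\<lambda>s. ln (\<rho> s)) has_real_derivative - u r / r) (at r)"
  using g_deriv[of r] u_deriv[of r] mass_log_deriv[of r] density_powr_deriv[of r a] density_log_deriv[of r]
    ln_density_deriv[of r] assms at_interior[of r] by auto

lemma u_le:
  assumes r: "0 < r" "r \<le> R"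
  shows "u r \<le> 4 * pi * \<rho> 0 / d * R\<^sup>2 / (\<gamma> * \<rho> R powr (\<gamma> - 1))"
proof -
  have pos: "0 < \<rho> R" "0 < \<rho> r" "0 < \<rho> 0" using \<rho>_pos r R by auto
  have "u r = M r / r ^ d * r\<^sup>2 / (\<gamma> * \<rho> r powr (\<gamma> - 1))" by (simp add: u_def)
  also have "\<dots> \<le> 4 * pi * \<rho> 0 / d * R\<^sup>2 / (\<gamma> * \<rho> R powr (\<gamma> - 1))"
  proof (rule frac_le[OF mult_nonneg_nonneg mult_mono])
    show "M r / r ^ d \<le> 4 * pi * \<rho> 0 / d" using mass_le[of r] r by (simp add: field_simps)
    show "r\<^sup>2 \<le> R\<^sup>2" using r by (intro power_mono) auto
    show "\<gamma> * \<rho> R powr (\<gamma> - 1) \<le> \<gamma> * \<rho> r powr (\<gamma> - 1)"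
      using density_antimono[of r R] r g1 pos by (intro mult_left_mono powr_mono2) auto
  qed (use pos g1 in auto)
  finally show ?thesis .
qed

lemma tendsto_0: "continuous_on I f \<Longrightarrow> (f \<longlongrightarrow> f 0) (at_right 0)"
  using R by (auto simp: continuous_on_def at_within_Icc_at_right[OF R, symmetric])

lemma eventually_small: "\<forall>\<^sub>F r in at_right 0. 0 < r \<and> r < R"
  using eventually_at_right_real[OF R] by eventually_elim simp

lemma D_bounded: "\<exists>B. \<forall>r. 0 < r \<longrightarrow> r \<le> R \<longrightarrow> \<bar>g r + u r - d\<bar> \<le> B"
proof (intro exI allI impI)
  fix r assume r: "0 < r" "r \<le> R"
  show "\<bar>g r + u r - d\<bar> \<le> d + 4 * pi * \<rho> 0 / d * R\<^sup>2 / (\<gamma> * \<rho> R powr (\<gamma> - 1))"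
    using g_pos[OF r] g_le[OF r] u_pos[OF r] u_le[OF r] by linarith
qed

text \<open>At the centre the formulas for \<open>g\<close> and \<open>u\<close> are quotients
  \<open>0 / 0\<close>. The limits of \<open>g\<close> and \<open>u\<close> are avoided: they are
  bounded, and the factor \<open>M\<close> tends to zero.\<close>

lemma D_mass_tendsto:
  assumes "continuous_on I h"
  shows "((\<lambda>r. (g r + u r - d) * (M r * h r)) \<longlongrightarrow> 0) (at_right 0)"
proof -
  obtain B where B: "\<And>r. 0 < r \<Longrightarrow> r \<le> R \<Longrightarrow> \<bar>g r + u r - d\<bar> \<le> B" using D_bounded by blast
  have "((\<lambda>r. B * \<bar>M r * h r\<bar>) \<longlongrightarrow> B * \<bar>M 0 * h 0\<bar>) (at_right 0)"
    by (intro tendsto_intros tendsto_0 mass_cont assms)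
  then show ?thesis
    by (intro Lim_null_comparison[of "\<lambda>r. (g r + u r - d) * (M r * h r)" "\<lambda>r. B * \<bar>M r * h r\<bar>"])
      (use B in \<open>auto simp: mass_0 abs_mult intro!: mult_right_mono eventually_mono[OF eventually_small]\<close>)
qed

text \<open>\<open>g + u = d\<close> is the line through the starting point \<open>(d, 0)\<close>
  and the fixed point. In this form it is visible that trajectories cross it towards
  \<open>g + u > d\<close> wherever \<open>u < u\<^sub>c\<close>.\<close>

lemma D_deriv:
  assumes r: "0 < r" "r < R"
  shows "((\<lambda>r. g r + u r - d) has_real_derivative
    ((u r - g r) * (g r + u r - d) - (2 - \<gamma>) * u r * (u r - u\<^sub>c)) / r) (at r)"
proof -
  have "(\<gamma> - 1) * u r = u r - (2 - \<gamma>) * u r" by algebra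
  moreover have "(2 - \<gamma>) * u r * (u r - u\<^sub>c) = (2 - \<gamma>) * u r * u r - 2 * u r"
    using arg_cong[OF fixed_point(1), of "\<lambda>x. u r * x"] by (simp add: algebra_simps)
  ultimately have "(d - u r - g r) * g r + (g r + (\<gamma> - 1) * u r - (real d - 2)) * u r
      = (u r - g r) * (g r + u r - d) - (2 - \<gamma>) * u r * (u r - u\<^sub>c)"
    by (simp add: algebra_simps)
  moreover have "((\<lambda>r. g r + u r - d) has_real_derivative
      ((d - u r - g r) * g r / r + (g r + (\<gamma> - 1) * u r - (real d - 2)) * u r / r - 0)) (at r)"
    by (intro DERIV_diff DERIV_add DERIV_const derivs_at r)
  ultimately show ?thesis by (simp add: add_divide_distrib[symmetric])
qed

text \<open>\<open>M * \<rho>\<close> is an integrating factor: its logarithmic rate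
  \<open>g - u\<close> cancels the first term of \<open>D_deriv\<close>. Where
  \<open>g + u \<le> d\<close>, the assumption \<open>g > g\<^sub>c\<close> forces
  \<open>u < u\<^sub>c\<close>, so the product increases. This yields the sector condition
  \<open>P + W > 0\<close>.\<close>

lemma D_pos:
  assumes above: "\<And>r. 0 < r \<Longrightarrow> r < R \<Longrightarrow> g\<^sub>c < g r" and y: "0 < y" "y < R"
  shows "0 < g y + u y - d"
proof -
  let ?f = "\<lambda>r. (g r + u r - d) * (M r * \<rho> r)"
  have pos: "0 < M r * \<rho> r" if "0 < r" "r < R" for r
    using mass_pos[of r] \<rho>_pos[of r] that by simp
  have "0 < ?f y"
  proof (rule positive_if_increasing_when_nonpositive[OF D_mass_tendsto[OF \<rho>_cont] _ _ y])
    fix r assume r: "0 < r" "r < R"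
    show "(?f has_real_derivative (2 - \<gamma>) * u r * (u\<^sub>c - u r) * (M r * \<rho> r) / r) (at r)"
      by (rule DERIV_cong[OF DERIV_mult[OF D_deriv[OF r] DERIV_mult[OF derivs_at(3)[OF r] derivs_at(5)[OF r]]]])
        (use r in \<open>simp add: field_simps\<close>)
    assume "?f r \<le> 0"
    then have "g r + u r - d \<le> 0" by (meson mult_pos_pos not_le pos r)
    then have "u r < u\<^sub>c" using above[OF r] by (simp add: g\<^sub>c_def)
    then show "0 < (2 - \<gamma>) * u r * (u\<^sub>c - u r) * (M r * \<rho> r) / r"
      using g2 u_pos[of r] pos[OF r] r by simp
  qed
  then show ?thesis by (rule zero_less_mult_pos2[OF _ pos[OF y]])
qed

text \<open>The clock of the phase plane, with rate \<open>u\<close> in \<open>ln r\<close>; its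
  value at \<open>R\<close> is the logarithm of the density ratio between centre and
  surface.\<close>

definition s where "s r = ln (\<rho> 0) - ln (\<rho> r)"

lemma s_cont: "continuous_on I s"
  unfolding s_def using \<rho>_pos by (intro continuous_intros \<rho>_cont) (auto simp: less_imp_neq[THEN not_sym])

lemma s_deriv: "0 < r \<Longrightarrow> r < R \<Longrightarrow> (s has_real_derivative u r / r) (at r)"
  unfolding s_def by (rule DERIV_cong[OF DERIV_diff[OF DERIV_const derivs_at(6)]]) auto

text \<open>The weight \<open>exp ((2 - \<gamma>) * s)\<close> is chosen so that the derivative of
  \<open>?X\<close> collapses to a positive multiple of \<open>g + u - d\<close>, positive by
  \<open>D_pos\<close>. Near the centre only \<open>u > 0\<close> is used; it gives the lower limit
  \<open>- u\<^sub>c\<close>.\<close>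

lemma u_lower_bound:
  assumes above: "\<And>r. 0 < r \<Longrightarrow> r < R \<Longrightarrow> g\<^sub>c < g r" and y: "0 < y" "y < R"
  shows "- u\<^sub>c * exp (- (2 - \<gamma>) * s y) \<le> u y - u\<^sub>c"
proof -
  define c where "c = 2 - \<gamma>"
  let ?X = "\<lambda>r. (u r - u\<^sub>c) * exp (c * s r)"
  have mono: "?X x \<le> ?X y" if "0 < x" "x < y" for x
  proof (rule DERIV_nonneg_imp_nondecreasing[of x y ?X])
    fix r assume "x \<le> r" "r \<le> y"
    then have r: "0 < r" "r < R" using that y by auto
    have "(?X has_real_derivative (u r * (g r + u r - d) * exp (c * s r)) / r) (at r)"
    proof (rule DERIV_cong[OF DERIV_mult[OF DERIV_diff[OF derivs_at(2)[OF r] DERIV_const]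
          DERIV_chain2[OF DERIV_exp DERIV_cmult[OF s_deriv[OF r]]]]])
      have "g r + (\<gamma> - 1) * u r - (real d - 2) + c * (u r - u\<^sub>c) = g r + u r - d"
        using fixed_point(1) unfolding c_def by (simp add: algebra_simps)
      then show "((g r + (\<gamma> - 1) * u r - (real d - 2)) * u r / r - 0) * exp (c * s r)
          + exp (c * s r) * (c * (u r / r)) * (u r - u\<^sub>c) = u r * (g r + u r - d) * exp (c * s r) / r"
        using r by (simp add: field_simps) algebra
    qed
    moreover have "0 \<le> (u r * (g r + u r - d) * exp (c * s r)) / r"
      using D_pos[OF above r] u_pos[of r] r by simp
    ultimately show "\<exists>D. (?X has_real_derivative D) (at r) \<and> 0 \<le> D" by blast
  qed (use that in auto)
  have "((\<lambda>x. - u\<^sub>c * exp (c * s x)) \<longlongrightarrow> - u\<^sub>c * exp (c * s 0)) (at_right 0)"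
    by (intro tendsto_intros tendsto_0 s_cont)
  moreover have "\<forall>\<^sub>F x in at_right 0. - u\<^sub>c * exp (c * s x) \<le> ?X y"
    using eventually_at_right_real[OF y(1)]
  proof eventually_elim
    case (elim x)
    have "- u\<^sub>c * exp (c * s x) \<le> ?X x" using u_pos[of x] elim y by (intro mult_right_mono) auto
    also have "\<dots> \<le> ?X y" using mono elim by auto
    finally show ?case .
  qed
  ultimately have "- u\<^sub>c * exp (c * s 0) \<le> ?X y"
    by (rule tendsto_upperbound) simp
  then have "- u\<^sub>c \<le> (u y - u\<^sub>c) * exp (c * s y)" by (simp add: s_def)
  then have "- u\<^sub>c * exp (- c * s y) \<le> (u y - u\<^sub>c) * exp (c * s y) * exp (- c * s y)"
    by (intro mult_right_mono) auto
  then have "- u\<^sub>c * exp (- c * s y) \<le> u y - u\<^sub>c" by (simp add: mult.assoc flip: exp_add)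
  then show ?thesis unfolding c_def .
qed

text \<open>The threshold in \<open>large\<close> involves \<open>d\<close>,
  \<open>\<gamma>\<close>, \<open>m\<close> and \<open>\<epsilon>\<close> but not the star, so one
  threshold serves all of them. The time bound applies to \<open>P = g - g\<^sub>c\<close> and
  \<open>W = u - u\<^sub>c\<close>; \<open>g \<le> d\<close> supplies
  \<open>P \<le> u\<^sub>c\<close>.\<close>

lemma crossing:
  assumes m: "0 < m" and \<epsilon>: "0 < \<epsilon>"
    and form: "\<And>P W. 0 < P \<Longrightarrow> - P \<le> W \<Longrightarrow>
        m * (P\<^sup>2 + W\<^sup>2) \<le> (u\<^sub>c - 2 * \<epsilon>) * P\<^sup>2 + (real d - 2) * P * W + g\<^sub>c * W\<^sup>2"
    and large: "max 1 (ln (u\<^sub>c / \<epsilon>) / (2 - \<gamma>)) + (u\<^sub>c + 4 * (g\<^sub>c * u\<^sub>c / m)) / g\<^sub>c < s R"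
  shows "\<exists>r. 0 < r \<and> r < R \<and> g r \<le> g\<^sub>c"
proof (rule ccontr)
  let ?S = "max 1 (ln (u\<^sub>c / \<epsilon>) / (2 - \<gamma>)) + (u\<^sub>c + 4 * (g\<^sub>c * u\<^sub>c / m)) / g\<^sub>c"
  assume "\<not> ?thesis"
  then have above: "g\<^sub>c < g r" if "0 < r" "r < R" for r using that by (meson not_le)
  have "s y \<le> ?S" if y: "0 < y" "y < R" for y
    unfolding g\<^sub>c_def
  proof (rule phase_plane_time_bound[where P="\<lambda>r. g r - g\<^sub>c" and W="\<lambda>r. u r - u\<^sub>c" and R=R and \<gamma>=\<gamma> and s=s and y=y])
    show "(2 - \<gamma>) * u\<^sub>c = 2" by (rule fixed_point)
    show "m * (P\<^sup>2 + W\<^sup>2) \<le> (u\<^sub>c - 2 * \<epsilon>) * P\<^sup>2 + (real d - 2) * P * W + (real d - u\<^sub>c) * W\<^sup>2"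
      if "0 < P" "- P \<le> W" for P W
      using form[OF that] d3 by (simp add: g\<^sub>c_def)
    fix r assume r: "0 < r" "r < R"
    show "((\<lambda>r. g r - g\<^sub>c) has_real_derivative
        - (real d - u\<^sub>c + (g r - g\<^sub>c)) * (g r - g\<^sub>c + (u r - u\<^sub>c)) / r) (at r)"
      by (rule DERIV_cong[OF DERIV_diff[OF derivs_at(1)[OF r] DERIV_const]])
        (simp add: g\<^sub>c_def algebra_simps)
    have "(u\<^sub>c + (u r - u\<^sub>c)) * (g r - g\<^sub>c + (\<gamma> - 1) * (u r - u\<^sub>c))
        = (g r + (\<gamma> - 1) * u r - (real d - 2)) * u r"
      using arg_cong[OF fixed_point(1), of "\<lambda>x. u r * x"] unfolding g\<^sub>c_def by (simp add: algebra_simps)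
    then show "((\<lambda>r. u r - u\<^sub>c) has_real_derivative
        (u\<^sub>c + (u r - u\<^sub>c)) * (g r - g\<^sub>c + (\<gamma> - 1) * (u r - u\<^sub>c)) / r) (at r)"
      by (intro DERIV_cong[OF DERIV_diff[OF derivs_at(2)[OF r] DERIV_const]]) (simp only: diff_zero)
    show "(s has_real_derivative (u\<^sub>c + (u r - u\<^sub>c)) / r) (at r)" using s_deriv[OF r] by simp
    show "0 < g r - g\<^sub>c" using above[OF r] by simp
    show "g r - g\<^sub>c \<le> u\<^sub>c" using g_le[of r] r by (simp add: g\<^sub>c_def)
    show "0 < g r - g\<^sub>c + (u r - u\<^sub>c)" using D_pos[OF above r] by (simp add: g\<^sub>c_def)
    show "- u\<^sub>c * exp (- (2 - \<gamma>) * s r) \<le> u r - u\<^sub>c" by (rule u_lower_bound[OF above r])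
  qed (use m \<epsilon> fixed_point g1 g2 y s_cont in \<open>auto simp: s_def g\<^sub>c_def\<close>)
  moreover have "(s \<longlongrightarrow> s R) (at_left R)"
    using s_cont R by (auto simp: continuous_on_def at_within_Icc_at_left[OF R, symmetric])
  moreover have "\<forall>\<^sub>F y in at_left R. s y \<le> ?S"
    using eventually_at_left_real[OF R] by eventually_elim (use calculation(1) in auto)
  ultimately have "s R \<le> ?S" by (intro tendsto_upperbound) auto
  then show False using large by simp
qed

section \<open>The neutral mode and the growing mode\<close>

text \<open>\<open>\<eta>\<close> is the displacement, at fixed mass, along the scaling family of equilibria
  \<open>\<kappa> * \<rho> (\<kappa> powr ((2 - \<gamma>) / 2) * r)\<close>; hence it solves the linearised equation with \<open>\<lambda> = 0\<close>.
  It changes sign exactly where \<open>g\<close> crosses \<open>g\<^sub>c\<close>. The case distinction at \<open>0\<close> is needed as \<open>g 0 = 0 / 0\<close>.\<close>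

definition a where "a = d / u\<^sub>c"
definition \<eta> where "\<eta> r = (if r = 0 then 1 else a * (g r - g\<^sub>c) / g r)"
definition V0 where "V0 r = - (a * g\<^sub>c / (4 * pi)) * ((g r + u r - d) * (M r * \<rho> r powr (\<gamma> - 1)))"

text \<open>The coefficients of the eigenvalue equation after division by \<open>- \<gamma>\<close>,
  with \<open>\<mu>\<close> for the squared growth rate and the pressure gradient expressed by the
  mass, which turns \<open>y ^ d * (\<rho> powr \<gamma>)'\<close> into
  \<open>- y * \<rho> * M\<close>.\<close>

definition p where "p r = \<rho> r powr \<gamma> * r ^ (d + 1)"
definition \<alpha> where "\<alpha> r = r ^ (d + 1) * \<rho> r / \<gamma>"
definition \<beta> where "\<beta> r = (2 * (real d - 1) - real d * \<gamma>) * r * \<rho> r * M r / \<gamma>"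

text \<open>The same condition as \<open>0 < g\<^sub>c\<close>, since this coefficient equals
  \<open>(2 - \<gamma>) * g\<^sub>c\<close>.\<close>

lemma stiffness_pos: "0 < 2 * (real d - 1) - real d * \<gamma>"
  using gd d3 by (simp add: field_simps)

text \<open>The first entry of the maximum bounds \<open>\<beta> / \<alpha>\<close>, because
  \<open>M r\<close> is at most a multiple of \<open>r ^ d\<close>. The second bounds
  \<open>\<alpha> z / p y\<close>, because the density decreases and
  \<open>\<gamma> \<ge> 1\<close>.\<close>

sublocale shooting R "max ((2 * (real d - 1) - real d * \<gamma>) * (4 * pi * \<rho> 0 / d)) (\<rho> 0 / \<rho> R powr \<gamma>)" p \<alpha> \<beta>
proof
  let ?k = "2 * (real d - 1) - real d * \<gamma>"
  let ?C = "max (?k * (4 * pi * \<rho> 0 / d)) (\<rho> 0 / \<rho> R powr \<gamma>)"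
  have pos: "0 < \<rho> 0" "0 < \<rho> R" using \<rho>_pos R by auto
  show "0 < R" by (rule R)
  show "0 \<le> ?C" using pos by (auto simp: le_max_iff_disj)
  show "continuous_on I p" "continuous_on I \<alpha>" "continuous_on I \<beta>"
    unfolding p_def \<alpha>_def \<beta>_def using \<rho>_pos g1
    by (intro continuous_intros \<rho>_cont mass_cont; force)+
  show "0 < p y" if "y \<in> {0<..R}" for y using that \<rho>_pos[of y] by (simp add: p_def)
  show "0 \<le> \<alpha> y" if "y \<in> I" for y using that \<rho>_pos[of y] g1 by (simp add: \<alpha>_def)
  show "\<bar>\<beta> y\<bar> \<le> ?C * \<alpha> y" if y: "y \<in> I" for y
  proof -
    have M0: "0 \<le> M y" using mass_pos[of y] mass_0 y by (cases "y = 0") auto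
    have \<rho>0: "0 \<le> y * \<rho> y / \<gamma>" using \<rho>_pos[of y] y g1 by auto
    have "\<bar>\<beta> y\<bar> = (y * \<rho> y / \<gamma>) * (?k * M y)"
      using M0 \<rho>0 stiffness_pos \<rho>_pos[of y] y g1 by (simp add: \<beta>_def abs_mult)
    also have "\<dots> \<le> (y * \<rho> y / \<gamma>) * (?k * (4 * pi * \<rho> 0 * y ^ d / d))"
      using \<rho>0 stiffness_pos mass_le[OF y] by (intro mult_left_mono) auto
    also have "\<dots> = ?k * (4 * pi * \<rho> 0 / d) * \<alpha> y"
      by (simp add: \<alpha>_def mult_ac)
    also have "\<dots> \<le> ?C * \<alpha> y"
      using that \<rho>_pos[of y] g1 by (intro mult_right_mono) (auto simp: \<alpha>_def)
    finally show ?thesis .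
  qed
  show "\<alpha> z \<le> ?C * p y" if "0 \<le> z" "z \<le> y" "y \<le> R" for z y
  proof -
    have \<rho>z: "\<rho> z \<le> \<rho> 0" "\<rho> R \<le> \<rho> y" "0 < \<rho> z" "0 < \<rho> y"
      using density_antimono \<rho>_pos[of z] \<rho>_pos[of y] that by auto
    have "\<alpha> z \<le> z ^ (d + 1) * \<rho> z / 1"
      unfolding \<alpha>_def using \<rho>z that g1 by (intro divide_left_mono) auto
    also have "\<dots> = z ^ (d + 1) * \<rho> z" by simp
    also have "\<dots> \<le> y ^ (d + 1) * \<rho> 0"
      using that \<rho>z by (intro mult_mono power_mono) auto
    also have "\<dots> \<le> y ^ (d + 1) * (\<rho> 0 / \<rho> R powr \<gamma> * \<rho> y powr \<gamma>)"
    proof (rule mult_left_mono)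
      have "\<rho> R powr \<gamma> \<le> \<rho> y powr \<gamma>" using \<rho>z pos g1 by (intro powr_mono2) auto
      then show "\<rho> 0 \<le> \<rho> 0 / \<rho> R powr \<gamma> * \<rho> y powr \<gamma>"
        using pos by (simp add: divide_simps)
    qed (use that in auto)
    also have "\<dots> = \<rho> 0 / \<rho> R powr \<gamma> * p y" by (simp add: p_def)
    also have "\<dots> \<le> ?C * p y" using \<rho>z that by (intro mult_right_mono) (auto simp: p_def)
    finally show ?thesis .
  qed
qed

lemma mass_density_g:
  assumes "0 < r" "r \<le> R"
  shows "M r * g r = 4 * pi * r ^ d * \<rho> r"
  using mass_pos[OF assms] by (simp add: g_def)

lemma u_mass:
  assumes "0 < r" "r \<le> R"
  shows "u r * (\<gamma> * \<rho> r powr (\<gamma> - 1) * r ^ d) = M r * r\<^sup>2"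
  using assms \<rho>_pos[of r] g1 by (simp add: u_def)

lemma \<eta>_cont: "continuous_on I \<eta>"
  unfolding continuous_on_eq_continuous_within
proof
  fix r assume r: "r \<in> I"
  show "continuous (at r within I) \<eta>"
  proof (cases "r = 0")
    case True
    \<comment> \<open>\<open>g\<close> is squeezed between this function and \<open>d\<close>. The
      constant \<open>a\<close> normalises the resulting limit of \<open>\<eta>\<close> to 1, the
      initial value of \<open>\<xi> 0\<close>.\<close>
    have "((\<lambda>r. d * \<rho> r / \<rho> 0) \<longlongrightarrow> d * \<rho> 0 / \<rho> 0) (at_right 0)"
      using \<rho>_pos[of 0] R by (intro tendsto_intros tendsto_0 \<rho>_cont) auto
    then have "((\<lambda>r. d * \<rho> r / \<rho> 0) \<longlongrightarrow> d) (at_right 0)"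
      using \<rho>_pos[of 0] R by simp
    then have "(g \<longlongrightarrow> d) (at_right 0)"
      by (rule tendsto_sandwich[rotated 2, OF _ tendsto_const])
        (use g_le g_ge in \<open>auto intro!: eventually_mono[OF eventually_small]\<close>)
    then have "((\<lambda>r. a * (g r - g\<^sub>c) / g r) \<longlongrightarrow> a * (d - g\<^sub>c) / d) (at_right 0)"
      using d3 by (intro tendsto_intros) auto
    also have "a * (d - g\<^sub>c) / d = 1" using fixed_point d3 by (simp add: a_def g\<^sub>c_def)
    finally have lim: "((\<lambda>r. a * (g r - g\<^sub>c) / g r) \<longlongrightarrow> 1) (at_right 0)" .
    have "\<forall>\<^sub>F r in at_right 0. a * (g r - g\<^sub>c) / g r = \<eta> r"
      using eventually_small by eventually_elim (simp add: \<eta>_def)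
    with lim have "(\<eta> \<longlongrightarrow> 1) (at_right 0)" by (rule Lim_transform_eventually)
    then show ?thesis using True R by (simp add: continuous_within \<eta>_def at_within_Icc_at_right)
  next
    case False
    then have r': "0 < r" "r \<le> R" using r by auto
    have "((\<lambda>r. a * (g r - g\<^sub>c) / g r) has_real_derivative
        ((a * ((d - u r - g r) * g r / r - 0)) * g r - a * (g r - g\<^sub>c) * ((d - u r - g r) * g r / r)) / (g r * g r)) (at r within I)"
      using g_pos[OF r'] by (intro DERIV_divide DERIV_cmult DERIV_diff DERIV_const g_deriv r') auto
    then have "continuous (at r within I) (\<lambda>r. a * (g r - g\<^sub>c) / g r)" by (rule DERIV_continuous)
    then show ?thesis
      by (rule continuous_transform_within[OF _ r'(1) r]) (auto simp: \<eta>_def dist_real_def)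
  qed
qed

lemma V0_cont: "continuous_on I V0"
  unfolding continuous_on_eq_continuous_within
proof
  fix r assume r: "r \<in> I"
  show "continuous (at r within I) V0"
  proof (cases "r = 0")
    case True
    have "continuous_on I (\<lambda>r. \<rho> r powr (\<gamma> - 1))"
      using \<rho>_pos by (intro continuous_intros \<rho>_cont) force
    from D_mass_tendsto[OF this]
    have "((\<lambda>r. - (a * g\<^sub>c / (4 * pi)) * ((g r + u r - d) * (M r * \<rho> r powr (\<gamma> - 1)))) \<longlongrightarrow>
        - (a * g\<^sub>c / (4 * pi)) * 0) (at_right 0)"
      by (rule tendsto_mult_left)
    then show ?thesis using True R
      by (simp add: continuous_within V0_def[abs_def] at_within_Icc_at_right mass_0)
  next
    case False
    then have r': "0 < r" "r \<le> R" using r by auto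
    have c: "continuous (at r within I) g" "continuous (at r within I) u" "continuous (at r within I) M"
      "continuous (at r within I) (\<lambda>r. \<rho> r powr (\<gamma> - 1))"
      using g_deriv[OF r'] u_deriv[OF r'] mass_log_deriv[OF r'] density_powr_deriv[OF r', of "\<gamma> - 1"]
      by (auto dest: DERIV_continuous)
    show ?thesis unfolding V0_def[abs_def]
      by (intro continuous_mult continuous_diff continuous_add continuous_const c)
  qed
qed

text \<open>\<open>\<eta>\<close> is \<open>a * (1 - g\<^sub>c / g)\<close>, so its derivative is
  \<open>a * g\<^sub>c * g' / g\<^sup>2\<close>; the identity
  \<open>M * g = 4 * pi * r ^ d * \<rho>\<close> turns the flux \<open>p * \<eta>'\<close> into
  \<open>V0\<close>.\<close>

lemma \<eta>_deriv:
  assumes r: "0 < r" "r < R"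
  shows "(\<eta> has_real_derivative V0 r / p r) (at r)"
proof -
  have r': "0 < r" "r \<le> R" using r by auto
  have \<rho>: "0 < \<rho> r" using \<rho>_pos r by simp
  have g0: "g r \<noteq> 0" using g_pos[OF r'] by simp
  have pw: "\<rho> r powr \<gamma> = \<rho> r powr (\<gamma> - 1) * \<rho> r" using \<rho> by (simp add: powr_diff)
  have "V0 r / p r = a * g\<^sub>c * (d - u r - g r) / (g r * r)"
  proof -
    have "V0 r * (g r * r) = a * g\<^sub>c * (d - u r - g r) * (\<rho> r powr (\<gamma> - 1)) * (M r * g r) * r / (4 * pi)"
      by (simp add: V0_def field_simps)
    also have "\<dots> = a * g\<^sub>c * (d - u r - g r) * p r"
      unfolding mass_density_g[OF r'] p_def pw by simp
    finally show ?thesis using p_pos[of r] r g0 by (simp add: field_simps)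
  qed
  moreover have "((\<lambda>r. a * (g r - g\<^sub>c) / g r) has_real_derivative
      ((a * ((d - u r - g r) * g r / r - 0)) * g r - a * (g r - g\<^sub>c) * ((d - u r - g r) * g r / r)) / (g r * g r)) (at r)"
    using g0 by (intro DERIV_divide DERIV_cmult DERIV_diff DERIV_const derivs_at r) auto
  moreover have "((a * ((d - u r - g r) * g r / r - 0)) * g r - a * (g r - g\<^sub>c) * ((d - u r - g r) * g r / r)) / (g r * g r)
      = a * g\<^sub>c * (d - u r - g r) / (g r * r)"
    using g0 r by (simp add: divide_simps) (simp add: algebra_simps)
  ultimately have "((\<lambda>r. a * (g r - g\<^sub>c) / g r) has_real_derivative V0 r / p r) (at r)" by simp
  then show ?thesis
    by (rule has_field_derivative_transform_within[OF _ r(1) UNIV_I]) (auto simp: \<eta>_def dist_real_def)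
qed

text \<open>The rates of \<open>M\<close> and \<open>\<rho> powr (\<gamma> - 1)\<close> combine with
  \<open>D_deriv\<close> to \<open>(2 - \<gamma>) * u * (D - (u - u\<^sub>c))\<close>, where
  \<open>D = g + u - d\<close>. The bracket is \<open>g - g\<^sub>c\<close>, again the numerator of
  \<open>\<eta>\<close>.\<close>

lemma V0_deriv:
  assumes r: "0 < r" "r < R"
  shows "(V0 has_real_derivative q 0 r * \<eta> r) (at r)"
proof -
  have r': "0 < r" "r \<le> R" using r by auto
  let ?h = "\<rho> r powr (\<gamma> - 1)"
  let ?D = "g r + u r - d"
  have "(V0 has_real_derivative - (a * g\<^sub>c / (4 * pi)) *
      (((u r - g r) * ?D - (2 - \<gamma>) * u r * (u r - u\<^sub>c)) / r * (M r * ?h)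
       + (g r * M r / r * ?h + - (\<gamma> - 1) * u r * ?h / r * M r) * ?D)) (at r)"
    unfolding V0_def[abs_def]
    by (intro DERIV_cmult DERIV_mult D_deriv derivs_at r)
  moreover have "- (a * g\<^sub>c / (4 * pi)) *
      (((u r - g r) * ?D - (2 - \<gamma>) * u r * (u r - u\<^sub>c)) / r * (M r * ?h)
       + (g r * M r / r * ?h + - (\<gamma> - 1) * u r * ?h / r * M r) * ?D) = q 0 r * \<eta> r"
  proof -
    have "((u r - g r) * ?D - (2 - \<gamma>) * u r * (u r - u\<^sub>c)) / r * (M r * ?h)
       + (g r * M r / r * ?h + - (\<gamma> - 1) * u r * ?h / r * M r) * ?D
       = (2 - \<gamma>) * (u r * ?h) * M r * (g r - g\<^sub>c) / r"
      using r by (simp add: g\<^sub>c_def field_simps)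
    moreover have "u r * ?h = M r * r\<^sup>2 / (\<gamma> * r ^ d)"
      using u_mass[OF r'] r g1 by (simp add: field_simps)
    moreover have "q 0 r * \<eta> r = - (a * (g\<^sub>c * (2 - \<gamma>)) * M r * M r * r * (g r - g\<^sub>c) / (4 * pi * \<gamma> * r ^ d))"
    proof -
      have "\<rho> r = M r * g r / (4 * pi * r ^ d)" using mass_density_g[OF r'] r by (simp add: field_simps)
      moreover have "g\<^sub>c * (2 - \<gamma>) = 2 * (real d - 1) - real d * \<gamma>"
        using fixed_point(1) by (simp add: g\<^sub>c_def algebra_simps)
      moreover have "q 0 r * \<eta> r = - ((2 * (real d - 1) - real d * \<gamma>) * r * \<rho> r * M r / \<gamma> * (a * (g r - g\<^sub>c) / g r))"
        using r by (simp add: q_def \<beta>_def \<eta>_def)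
      ultimately show ?thesis using g_pos[OF r'] by (simp add: mult_ac)
    qed
    moreover have "- (a * g\<^sub>c / (4 * pi)) * ((2 - \<gamma>) * (M r * r\<^sup>2 / (\<gamma> * r ^ d)) * M r * (g r - g\<^sub>c) / r)
        = - (a * (g\<^sub>c * (2 - \<gamma>)) * M r * M r * r * (g r - g\<^sub>c) / (4 * pi * \<gamma> * r ^ d))"
      using r g1 by (simp add: divide_simps power2_eq_square)
    ultimately show ?thesis by (simp only:)
  qed
  ultimately show ?thesis by simp
qed

theorem growing_mode_exists:
  assumes r: "0 < r" "r < R" "g r \<le> g\<^sub>c"
  shows "\<exists>lam w. growing_mode TYPE('a::euclidean_space) d \<gamma> \<rho> R lam w"
proof -
  have "\<eta> r = \<xi> 0 r"
    by (rule \<xi>_unique[OF \<eta>_cont _ V0_cont _ \<eta>_deriv V0_deriv]) (use r in \<open>auto simp: \<eta>_def V0_def mass_0\<close>)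
  moreover have "\<eta> r \<le> 0"
    using r g_pos[of r] fixed_point d3
    by (auto simp: \<eta>_def a_def intro!: divide_nonpos_pos mult_nonneg_nonpos)
  ultimately have "\<xi> 0 r \<le> 0" by simp
  moreover have pR: "0 < p R" using p_pos R by simp
  \<comment> \<open>With \<open>V = p * \<xi>'\<close> this weight makes the functional
    \<open>p R / R\<close> times the left-hand side of the boundary condition.\<close>
  ultimately obtain \<mu> where \<mu>: "0 < \<mu>" "d * p R / R * \<xi> \<mu> R + V \<mu> R = 0"
    using shooting[of r "d * p R / R"] r R d3 by auto
  define w1 where "w1 y = V \<mu> y / p y" for y
  define p' where "p' y = (\<rho> y powr \<gamma>) * (d + 1) * y ^ d - \<rho> y * M y / y ^ (d - 1) * y ^ (d + 1)" for y
  define w2 where "w2 y = (q \<mu> y * \<xi> \<mu> y * p y - V \<mu> y * p' y) / (p y * p y)" for y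
  have sub: "{0<..R} \<subseteq> I" by auto
  have dP: "((\<lambda>s. \<rho> s powr \<gamma>) has_real_derivative (- \<rho> y * M y / y ^ (d - 1))) (at y within {0<..R})"
    if "y \<in> {0<..R}" for y
    by (rule has_field_derivative_at_within[OF lane_emden[OF that]])
  have dp: "(p has_real_derivative p' y) (at y within {0<..R})" if y: "y \<in> {0<..R}" for y
    unfolding p_def[abs_def]
    by (rule DERIV_cong[OF DERIV_mult[OF dP[OF y] DERIV_subset[OF DERIV_pow subset_UNIV]]])
      (simp add: p'_def)
  have dV: "(V \<mu> has_real_derivative q \<mu> y * \<xi> \<mu> y) (at y within {0<..R})" if "y \<in> {0<..R}" for y
    using DERIV_subset[OF V_deriv sub] that by auto
  have dw: "(\<xi> \<mu> has_real_derivative w1 y) (at y within {0<..R})" if "y \<in> {0<..R}" for y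
    using DERIV_subset[OF \<xi>_deriv sub] that by (auto simp: w1_def)
  have dw1: "(w1 has_real_derivative w2 y) (at y within {0<..R})" if y: "y \<in> {0<..R}" for y
    unfolding w1_def[abs_def] w2_def
    using DERIV_divide[OF dV[OF y] dp[OF y]] p_pos[OF y] by simp
  have cont2: "continuous_on {0<..R} w2"
  proof -
    have "continuous_on {0<..R} f" if "continuous_on I f" for f :: "real \<Rightarrow> real"
      by (rule continuous_on_subset[OF that sub])
    note c = this[OF \<rho>_cont] this[OF mass_cont] this[OF V_cont] this[OF \<xi>(1)] this[OF q_cont] this[OF cont(1)]
    have nz: "p y \<noteq> 0" "\<rho> y \<noteq> 0" if "0 < y" "y \<le> R" for y
      using p_pos[of y] \<rho>_pos[of y] that by auto
    show ?thesis
      unfolding w2_def[abs_def] p'_def[abs_def]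
      by (intro continuous_intros c) (auto simp: nz)
  qed
  have ode: "- \<gamma> * (q \<mu> y * \<xi> \<mu> y) + (2 * (real d - 1) - real d * \<gamma>) * y ^ d * (- \<rho> y * M y / y ^ (d - 1)) * \<xi> \<mu> y
      = - (sqrt \<mu>)\<^sup>2 * y ^ (d + 1) * \<rho> y * \<xi> \<mu> y" if y: "y \<in> {0<..R}" for y
  proof -
    have "y ^ d * (- \<rho> y * M y / y ^ (d - 1)) = - y * \<rho> y * M y"
      using y by (subst power_pred) auto
    moreover have "\<gamma> * q \<mu> y = \<mu> * y ^ (d + 1) * \<rho> y - (2 * (real d - 1) - real d * \<gamma>) * y * \<rho> y * M y"
      using g1 by (simp add: q_def \<alpha>_def \<beta>_def field_simps)
    moreover have "(sqrt \<mu>)\<^sup>2 = \<mu>" using \<mu>(1) by simp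
    moreover have "- \<gamma> * (Q * x) + k * Y * Z * x = - (\<gamma> * Q) * x + k * (Y * Z) * x" for Q x k Y Z :: real
      by (simp add: mult_ac)
    ultimately show ?thesis by (simp only:) (simp add: algebra_simps)
  qed
  have dV': "((\<lambda>s. \<rho> s powr \<gamma> * s ^ (d + 1) * w1 s) has_real_derivative q \<mu> y * \<xi> \<mu> y) (at y within {0<..R})"
    if y: "y \<in> {0<..R}" for y
  proof (rule has_field_derivative_transform_within[OF dV[OF y] zero_less_one y])
    show "V \<mu> x = \<rho> x powr \<gamma> * x ^ (d + 1) * w1 x" if "x \<in> {0<..R}" for x
      using p_pos[OF that] unfolding w1_def p_def[symmetric] by simp
  qed
  have "H1r TYPE('a) R (\<xi> \<mu>)"
  proof (rule H1r_of_C1[OF R])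
    \<comment> \<open>\<open>w1\<close> is \<open>A \<mu> (\<xi> \<mu>)\<close>, already known to be
      continuous up to the centre.\<close>
    show "continuous_on I w1"
      using A_cont[OF \<xi>(1), of \<mu> \<mu>] by (simp add: A_\<xi> w1_def[abs_def] flip: A_\<xi>)
    show "w1 0 = 0" by (simp add: w1_def V_0)
    show "(\<xi> \<mu> has_real_derivative w1 y) (at y within I)" if "y \<in> I" for y
      using \<xi>_deriv[OF that] by (simp add: w1_def)
  qed
  moreover have "real d * \<xi> \<mu> R + R * w1 R = 0"
    using \<mu>(2) R pR by (simp add: w1_def field_simps)
  \<comment> \<open>\<open>\<xi> \<mu> 0 = 1\<close> does not settle this directly, as the centre is
    excluded; continuity there carries it over.\<close>
  moreover have "\<exists>y\<in>{0<..R}. \<xi> \<mu> y \<noteq> 0"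
  proof (rule ccontr)
    assume "\<not> ?thesis"
    then have z: "\<xi> \<mu> y = 0" if "y \<in> {0<..R}" for y using that by blast
    then have "(\<xi> \<mu> \<longlongrightarrow> 0) (at_right 0)"
      by (intro tendsto_eventually eventually_mono[OF eventually_small]) auto
    then show False
      using tendsto_unique[OF trivial_limit_at_right_real _ tendsto_0[OF \<xi>(1)]] \<xi>_0 by fastforce
  qed
  moreover have "\<forall>y\<in>{0<..R}.
      (\<xi> \<mu> has_real_derivative w1 y) (at y within {0<..R}) \<and>
      (w1 has_real_derivative w2 y) (at y within {0<..R}) \<and>
      (\<exists>q' p'.
         ((\<lambda>s. \<rho> s powr \<gamma> * s ^ (d + 1) * w1 s) has_real_derivative q') (at y within {0<..R}) \<and>
         ((\<lambda>s. \<rho> s powr \<gamma>) has_real_derivative p') (at y within {0<..R}) \<and>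
         - \<gamma> * q' + (2 * (real d - 1) - real d * \<gamma>) * y ^ d * p' * \<xi> \<mu> y
           = - ((sqrt \<mu>)\<^sup>2) * y ^ (d + 1) * \<rho> y * \<xi> \<mu> y)"
    using dw dw1 dV' dP ode by blast
  ultimately have "growing_mode TYPE('a) d \<gamma> \<rho> R (sqrt \<mu>) (\<xi> \<mu>)"
    unfolding growing_mode_def using \<mu>(1) cont2 real_sqrt_gt_zero by blast
  then show ?thesis by blast
qed

end

theorem theorem1p1:
  fixes d :: nat and \<gamma> :: real
  assumes dim: "DIM('a::euclidean_space) = d + 2"
    and d3: "3 \<le> d" and d10: "d < 10"
    and g1: "1 \<le> \<gamma>" and g2: "\<gamma> < 2"
    and gd: "\<gamma> < 2 * (real d - 1) / real d"
  shows "\<exists>C>0. \<forall>\<rho>0 \<rho> Rg R.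
           C < \<rho>0 \<and> LE_profile d \<gamma> \<rho>0 \<rho> Rg \<and> 0 < R \<and> ereal R < Rg \<and> \<rho> R = 1
           \<longrightarrow> linearly_unstable TYPE('a) d \<gamma> \<rho> R"
proof -
  \<comment> \<open>The fixed point is written out again because the threshold must be fixed before
    any star is given, hence outside the locale.\<close>
  define uc where "uc = 2 / (2 - \<gamma>)"
  define gc where "gc = real d - uc"
  have "\<gamma> * d < 2 * (real d - 1)" using gd d3 by (simp add: field_simps)
  then have "2 \<le> uc" "uc < d" using g1 g2 by (auto simp: uc_def field_simps)
  then obtain m \<epsilon> where m: "0 < m" and \<epsilon>: "0 < \<epsilon>"
    and form: "\<And>P W. 0 < P \<Longrightarrow> - P \<le> W \<Longrightarrow>
        m * (P\<^sup>2 + W\<^sup>2) \<le> (uc - 2 * \<epsilon>) * P\<^sup>2 + (real d - 2) * P * W + gc * W\<^sup>2"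
    using angular_form_coercive[of "real d" uc] d3 d10 unfolding gc_def by auto
  define S where "S = max 1 (ln (uc / \<epsilon>) / (2 - \<gamma>)) + (uc + 4 * (gc * uc / m)) / gc"
  have "linearly_unstable TYPE('a) d \<gamma> \<rho> R"
    if \<rho>0: "exp S < \<rho>0" and prof: "LE_profile d \<gamma> \<rho>0 \<rho> Rg" and R: "0 < R" "ereal R < Rg" and \<rho>R: "\<rho> R = 1"
    for \<rho>0 \<rho> Rg R
  proof -
    have sol: "LE_sol d \<gamma> \<rho>0 \<rho> Rg" using prof by (simp add: LE_profile_def)
    have in_dom: "ereal r < Rg" if "r \<le> R" for r
      using that R(2) by (meson ereal_less_eq(3) le_less_trans)
    interpret liquid_star d \<gamma> R \<rho>
    proof
      show "continuous_on {0..R} \<rho>"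
        using sol in_dom unfolding LE_sol_def by (auto elim!: continuous_on_subset)
    qed (use d3 g1 gd R(1) sol in_dom in \<open>auto simp: LE_sol_def\<close>)
    have "\<rho> 0 = \<rho>0" using sol by (simp add: LE_sol_def)
    moreover have "S < ln \<rho>0" using \<rho>0 by (metis exp_gt_zero exp_less_mono exp_ln less_trans ln_exp ln_less_cancel_iff)
    \<comment> \<open>Because \<open>\<rho> R = 1\<close>, the clock at the surface reads exactly
      \<open>ln \<rho>0\<close>.\<close>
    ultimately have "S < s R" by (simp add: s_def \<rho>R)
    then have "\<exists>r. 0 < r \<and> r < R \<and> g r \<le> g\<^sub>c"
      using m \<epsilon> form unfolding S_def uc_def gc_def
      by (intro crossing[of m \<epsilon>]) (auto simp: u\<^sub>c_def g\<^sub>c_def)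
    then obtain r where "0 < r" "r < R" "g r \<le> g\<^sub>c" by blast
    then show ?thesis unfolding linearly_unstable_def by (rule growing_mode_exists)
  qed
  then show ?thesis by (intro exI[of _ "exp S"] conjI allI impI) auto
qed

end
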